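(* Let $V$ be a vector space over an algebraically closed field $k$ (of any characteristic), let $f_1,\dots,f_r$ be homogeneous elements of $P(V)$ of positive degree having infinite collective strength, and let $c_1,\dots,c_r\in k$. Then there exists $v\in V$ with $f_i(v)=c_i$ for all $1\le i\le r$.
   Context: For a $k$-vector space $V$ with basis $\{v_i\}_{i\in I}$ and dual coordinates $x_i$, $P_n(V)$ is the space of degree-$n$ polynomial functions on $V$: formal, possibly infinite, $k$-linear combinations of degree-$n$ monomials in the $x_i$, which can be evaluated at any $v\in V$. $P(V)=\bigoplus_{n\ge0}P_n(V)$. The strength of a homogeneous $f\in P_n(V)$, $n\ge1$, is the least $s$ with $f=\sum_{i=1}^s g_ih_i$, $g_i,h_i$ homogeneous in $P(V)$ of positive degree less than $n$ ($\infty$ if none exists); in particular nonzero linear forms have infinite strength. A collection of elements of $P(V)$ has infinite collective strength if every nontrivial $k$-linear combination of those members having a common degree has infinite strength. *)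

theory Defs
  imports "HOL-Library.Multiset" "HOL-Computational_Algebra.Polynomial"
begin

text \<open>V has basis indexed by type 'i; a vector is a finitely supported function 'i => 'k.
  Monomials in the dual coordinates x_i are finite multisets over 'i; a (possibly infinite)
  formal linear combination of monomials is a coefficient function 'i multiset => 'k.\<close>

definition is_vec :: "('i \<Rightarrow> 'k::zero) \<Rightarrow> bool" where
  "is_vec v \<longleftrightarrow> finite {i. v i \<noteq> 0}"

definition hom_of_deg :: "nat \<Rightarrow> ('i multiset \<Rightarrow> 'k::zero) \<Rightarrow> bool" where
  "hom_of_deg n f \<longleftrightarrow> (\<forall>m. size m \<noteq> n \<longrightarrow> f m = 0)"

definition pmult :: "('i multiset \<Rightarrow> 'k::comm_ring_1) \<Rightarrow> ('i multiset \<Rightarrow> 'k) \<Rightarrow> 'i multiset \<Rightarrow> 'k" where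
  "pmult f g m = (\<Sum>a\<in>{a. a \<subseteq># m}. f a * g (m - a))"

definition eval_hom :: "nat \<Rightarrow> ('i multiset \<Rightarrow> 'k::comm_ring_1) \<Rightarrow> ('i \<Rightarrow> 'k) \<Rightarrow> 'k" where
  "eval_hom n f v = (\<Sum>m\<in>{m. size m = n \<and> set_mset m \<subseteq> {i. v i \<noteq> 0}}.
                        f m * (\<Prod>i\<in>set_mset m. v i ^ count m i))"

definition strength_le :: "nat \<Rightarrow> ('i multiset \<Rightarrow> 'k::comm_ring_1) \<Rightarrow> nat \<Rightarrow> bool" where
  "strength_le n f s \<longleftrightarrow>
     (\<exists>(g :: nat \<Rightarrow> 'i multiset \<Rightarrow> 'k) (h :: nat \<Rightarrow> 'i multiset \<Rightarrow> 'k) dg dh.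
        (\<forall>j<s. 0 < dg j \<and> dg j < n \<and> 0 < dh j \<and> dh j < n
               \<and> hom_of_deg (dg j) (g j) \<and> hom_of_deg (dh j) (h j))
        \<and> f = (\<lambda>m. \<Sum>j<s. pmult (g j) (h j) m))"

definition infinite_strength :: "nat \<Rightarrow> ('i multiset \<Rightarrow> 'k::comm_ring_1) \<Rightarrow> bool" where
  "infinite_strength n f \<longleftrightarrow> (\<forall>s. \<not> strength_le n f s)"

definition inf_collective_strength ::
  "nat \<Rightarrow> (nat \<Rightarrow> nat) \<Rightarrow> (nat \<Rightarrow> 'i multiset \<Rightarrow> 'k::comm_ring_1) \<Rightarrow> bool" where
  "inf_collective_strength r d f \<longleftrightarrow>
     (\<forall>n (a :: nat \<Rightarrow> 'k). (\<exists>j<r. d j = n \<and> a j \<noteq> 0) \<longrightarrow>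
        infinite_strength n (\<lambda>m. \<Sum>j\<in>{j. j < r \<and> d j = n}. a j * f j m))"

end

theory Submission
  imports Defs "HOL-Library.Poly_Mapping" "HOL-Computational_Algebra.Primes"
begin

text \<open>
  The key is a Nullstellensatz: if \<open>x\<close> is homogeneous of degree \<open>n\<close> and vanishes wherever finitely
  many homogeneous \<open>y\<^sub>1, \<dots>, y\<^sub>m\<close> of degrees at most \<open>n\<close> vanish, then some \<open>x - \<Sum> a\<^sub>i y\<^sub>i\<close> (over the \<open>y\<^sub>i\<close>
  of degree \<open>n\<close>) has finite strength. One eliminates a \<open>y\<^sub>m\<close> of maximal degree \<open>\<delta>\<close>, replacing it by
  finitely many equations of smaller degree. If \<open>y\<^sub>m\<close> has finite strength modulo the others of its degree,
  its factors will do. Otherwise there is by induction an \<open>e\<close> with \<open>y\<^sub>m(e) = 1\<close> at which the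
  other \<open>y\<^sub>i\<close> vanish. Add the equations saying that all mixed terms of \<open>y\<^sub>i(v + te)\<close> vanish; on their
  zeros \<open>y\<^sub>m(v + te) = y\<^sub>m(v) + t^\<delta>\<close>, so that \<open>x(v + te) = 0\<close> for all roots of \<open>t^\<delta> = - y\<^sub>m(v)\<close>.
  Expanding in \<open>t\<close> expresses \<open>x(v)\<close>, or in characteristic \<open>p\<close> a power \<open>x(v)^q\<close> with \<open>q\<close> a power of
  \<open>p\<close>, through functions of degree less than \<open>n\<close>. When no equation is left, \<open>x^q\<close> is a polynomial in
  functions of smaller degree, and \<open>p\<close>-independence of elements of infinite collective strength
  shows the same for \<open>x\<close>.

  Surjectivity follows by adding the \<open>f\<^sub>i\<close> in order of increasing degree: if \<open>u\<close> solves the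
  previous equations, the Nullstellensatz provides a \<open>w\<close> at which the previous \<open>f\<^sub>j\<close> and all mixed
  terms with \<open>u\<close> vanish while \<open>f\<^sub>i(w) = c\<^sub>i - f\<^sub>i(u)\<close>, and \<open>u + w\<close> solves one more.
\<close>

section \<open>Algebraically closed fields\<close>

text \<open>Over a finite field, 1 plus the product of all X - a has positive degree but no
  root.\<close>

lemma infinite_UNIV_alg_closed: "infinite (UNIV :: 'k::alg_closed_field set)"
proof
  assume fin: "finite (UNIV :: 'k set)"
  define P :: "'k poly" where "P = (\<Prod>a\<in>UNIV. [:-a, 1:]) + 1"
  have "degree (\<Prod>a\<in>(UNIV::'k set). [:-a, 1:]) = card (UNIV :: 'k set)"
    by (subst degree_prod_sum_eq) auto
  moreover have "card (UNIV :: 'k set) > 0" using fin by (simp add: finite_UNIV_card_ge_0)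
  ultimately have "degree P > 0" unfolding P_def by (subst degree_add_eq_left) auto
  then obtain x where "poly P x = 0" using alg_closed_imp_poly_has_root by blast
  moreover have "poly (\<Prod>a\<in>(UNIV::'k set). [:-a, 1:]) x = 0"
    using fin by (auto simp: poly_prod)
  ultimately show False by (simp add: P_def)
qed

lemma poly_eq_0_of_values:
  fixes P :: "'k::alg_closed_field poly"
  assumes "\<And>t. poly P t = 0"
  shows "P = 0"
  using assms poly_roots_finite[of P] infinite_UNIV_alg_closed by auto

lemma poly_sum_le:
  fixes P :: "'k::field poly"
  assumes "degree P \<le> J"
  shows "poly P t = (\<Sum>j\<le>J. coeff P j * t ^ j)"
  unfolding poly_altdef using assms
  by (intro sum.mono_neutral_left) (auto simp: coeff_eq_0)

text \<open>In characteristic 0 this is just {1}, in characteristic p it is the set of all powers of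
  p. Allowing such exponents q everywhere treats both cases at once, as a q-th power is additive
  either way.\<close>

inductive_set char_powers :: "'k::alg_closed_field itself \<Rightarrow> nat set" for T where
  one: "1 \<in> char_powers T"
| step: "prime CHAR('k) \<Longrightarrow> q \<in> char_powers T \<Longrightarrow> CHAR('k) * q \<in> char_powers T"

lemma char_powers_pos: "q \<in> char_powers (TYPE('k::alg_closed_field)) \<Longrightarrow> q > 0"
  by (induction rule: char_powers.induct) (auto simp: prime_gt_0_nat)

lemma char_powers_mult:
  "q \<in> char_powers (TYPE('k::alg_closed_field)) \<Longrightarrow> r \<in> char_powers TYPE('k)
    \<Longrightarrow> q * r \<in> char_powers TYPE('k)"
  by (induction rule: char_powers.induct) (auto simp: mult.assoc intro: char_powers.step)

lemma char_powers_add: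
  fixes a b :: "'k::alg_closed_field"
  assumes "q \<in> char_powers TYPE('k)"
  shows "(a + b) ^ q = a ^ q + b ^ q"
  using assms
proof (induction arbitrary: a b rule: char_powers.induct)
  case (step q)
  have "(a + b) ^ CHAR('k) = a ^ CHAR('k) + b ^ CHAR('k)"
    using step.hyps(1) by (rule freshmans_dream) simp
  then show ?case by (simp add: power_mult step.IH)
qed auto

lemma char_powers_sum:
  fixes g :: "'b \<Rightarrow> 'k::alg_closed_field"
  assumes "q \<in> char_powers TYPE('k)"
  shows "(\<Sum>i\<in>I. g i) ^ q = (\<Sum>i\<in>I. g i ^ q)"
  using char_powers_pos[OF assms]
  by (induction I rule: infinite_finite_induct) (auto simp: char_powers_add[OF assms] power_0_left)

text \<open>The characteristic is divided out as long as the number is zero in \<open>'k\<close>. In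
  characteristic 0 this never happens, because n > 0.\<close>

lemma char_powers_decompose:
  assumes "n > 0"
  shows "\<exists>q m. n = q * m \<and> q \<in> char_powers TYPE('k::alg_closed_field) \<and> of_nat m \<noteq> (0::'k)"
  using assms
proof (induction n rule: less_induct)
  case (less n)
  show ?case
  proof (cases "of_nat n = (0::'k)")
    case True
    then have dvd: "CHAR('k) dvd n" by (simp add: of_nat_eq_0_iff_char_dvd)
    then have "CHAR('k) > 0" using less.prems by (cases "CHAR('k) = 0") auto
    then have prime: "prime CHAR('k)" by (rule prime_CHAR_semidom)
    obtain n' where n': "n = CHAR('k) * n'" using dvd by blast
    have "n' < n" "n' > 0" using n' prime_gt_1_nat[OF prime] less.prems by auto
    from less.IH[OF this] obtain q m where
      "n' = q * m" "q \<in> char_powers TYPE('k)" "of_nat m \<noteq> (0::'k)" by blast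
    then show ?thesis using n' prime by (metis char_powers.step mult.assoc)
  next
    case False
    then show ?thesis using char_powers.one by (intro exI[of _ 1] exI[of _ n]) auto
  qed
qed

text \<open>The derivative m t^(m-1) vanishes at most at 0, which is not a root of t^m - s as s is
  nonzero. Hence all roots are simple.\<close>

lemma card_roots_of_power:
  fixes s :: "'k::alg_closed_field"
  assumes "s \<noteq> 0" and m: "of_nat m \<noteq> (0::'k)"
  shows "card {t. t ^ m = s} = m"
proof -
  define g where "g = monom 1 m - [:s:]"
  have "m > 0" using m by (cases m) auto
  then have deg: "degree g = m" 
    unfolding g_def diff_conv_add_uminus by (subst degree_add_eq_left) (auto simp: degree_monom_eq)
  then have "g \<noteq> 0" using \<open>m > 0\<close> by auto
  then obtain A where A: "size A = degree g" "g = smult (lead_coeff g) (\<Prod>x\<in>#A. [:-x, 1:])"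
    using alg_closed_imp_factorization[of g] by blast
  have root: "poly g t = 0 \<longleftrightarrow> t ^ m = s" for t by (simp add: g_def poly_monom)
  have set: "set_mset A = {t. t ^ m = s}"
  proof -
    have "poly g t = 0 \<longleftrightarrow> t \<in># A" for t
      using \<open>g \<noteq> 0\<close> by (subst A(2)) (auto simp: poly_prod_mset)
    then show ?thesis using root by auto
  qed
  have "count A t \<le> 1" for t
  proof (rule ccontr)
    assume "\<not> count A t \<le> 1"
    then have "replicate_mset 2 t \<subseteq># A" by (simp add: count_le_replicate_mset_subset_eq[symmetric])
    then obtain B where B: "A = add_mset t (add_mset t B)"
      by (auto simp: numeral_2_eq_2 subset_mset.le_iff_add)
    have "[:-t, 1:] * [:-t, 1:] dvd g"
      by (subst A(2)) (auto simp: B mult.assoc[symmetric] simp del: mult_pCons_left mult_pCons_right intro!: dvd_smult)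
    then obtain h where h: "g = [:-t, 1:] * ([:-t, 1:] * h)" by (metis dvdE mult.assoc)
    have "poly (pderiv g) t = 0" unfolding h by (simp only: pderiv_mult poly_add poly_mult) simp
    then have "t = 0" using m by (auto simp: g_def pderiv_diff pderiv_monom poly_monom pderiv_pCons)
    moreover have "poly g t = 0" unfolding h by simp
    ultimately show False using root \<open>s \<noteq> 0\<close> \<open>m > 0\<close> by auto
  qed
  then have "count A t = (if t \<in># A then 1 else 0)" for t
    by (metis count_greater_eq_one_iff le_antisym not_in_iff)
  then have "A = mset_set (set_mset A)" by (intro multiset_eqI) (simp add: count_mset_set')
  then have "size A = card (set_mset A)" by (metis size_mset_set)
  then show ?thesis using A(1) deg set by simp
qed

text \<open>Here \<open>d = q * m\<close> with \<open>m\<close> prime to the characteristic, so that the \<open>q\<close>-th powers of the roots of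
  \<open>t ^ d = s\<close> are the \<open>m\<close> distinct roots of \<open>t ^ m = s\<close>.\<close>

lemma constant_on_roots:
  assumes "d > 0"
  shows "\<exists>q\<in>char_powers TYPE('k::alg_closed_field). \<exists>m. \<forall>(P :: 'k poly) s X J.
    degree P \<le> J \<longrightarrow> (\<forall>t. t ^ d = s \<longrightarrow> poly P t = X) \<longrightarrow>
    X ^ q = (\<Sum>j\<le>J. if m dvd j then coeff P j ^ q * s ^ (j div m) else 0)"
proof -
  obtain q m where d: "d = q * m" and q: "q \<in> char_powers TYPE('k)" and m: "of_nat m \<noteq> (0::'k)"
    using char_powers_decompose[OF assms] by blast
  have "m > 0" using m by (cases m) auto
  have "q > 0" using char_powers_pos[OF q] .
  have "X ^ q = (\<Sum>j\<le>J. if m dvd j then coeff P j ^ q * s ^ (j div m) else 0)"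
    if J: "degree P \<le> J" and X: "\<And>t. t ^ d = s \<Longrightarrow> poly P t = X" for P :: "'k poly" and s X J
  proof (cases "s = 0")
    case True
    have "X = coeff P 0" using X[of 0] assms True by (simp add: poly_0_coeff_0)
    moreover have "(\<Sum>j\<le>J. if m dvd j then coeff P j ^ q * s ^ (j div m) else 0)
        = (\<Sum>j\<le>J. if j = 0 then coeff P 0 ^ q else 0)"
      using True \<open>m > 0\<close> by (intro sum.cong) (auto simp: power_0_left dvd_div_eq_0_iff)
    ultimately show ?thesis by simp
  next
    case False
    \<comment> \<open>The q-th power of the equation P(t) = X is a polynomial equation in u = t^q.
      Reducing the exponents of u modulo m by means of u^m = s leaves \<open>R\<close>, which has
      degree less than m but m distinct roots.\<close>
    define R where "R = (\<Sum>j\<le>J. monom (coeff P j ^ q * s ^ (j div m)) (j mod m)) - [:X ^ q:]"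
    have "poly R u = 0" if u: "u ^ m = s" for u
    proof -
      obtain t where t: "t ^ q = u" using nth_root_exists[OF \<open>q > 0\<close>] by metis
      have "poly P t = X" using X[of t] t u d by (simp add: power_mult)
      then have "X ^ q = (\<Sum>j\<le>J. coeff P j * t ^ j) ^ q"
        using poly_sum_le[OF J] by metis
      also have "\<dots> = (\<Sum>j\<le>J. coeff P j ^ q * u ^ j)"
        unfolding char_powers_sum[OF q] t[symmetric]
        by (intro sum.cong) (auto simp: power_mult_distrib power_mult[symmetric] mult.commute)
      also have "\<dots> = (\<Sum>j\<le>J. coeff P j ^ q * s ^ (j div m) * u ^ (j mod m))"
        unfolding u[symmetric] power_mult[symmetric] mult.assoc power_add[symmetric] by simp
      finally show ?thesis by (simp add: R_def poly_sum poly_monom)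
    qed
    then have sub: "{u. u ^ m = s} \<subseteq> {u. poly R u = 0}" by auto
    have "degree R < m"
    proof -
      have "degree (\<Sum>j\<le>J. monom (coeff P j ^ q * s ^ (j div m)) (j mod m)) < m"
        using \<open>m > 0\<close> by (intro degree_sum_less) (auto intro!: le_less_trans[OF degree_monom_le])
      then show ?thesis unfolding R_def using \<open>m > 0\<close> by (intro degree_diff_less) auto
    qed
    have "R = 0"
    proof (rule ccontr)
      assume "R \<noteq> 0"
      then have "card {u. u ^ m = s} \<le> degree R"
        using card_mono[OF poly_roots_finite sub] card_poly_roots_bound[of R] by force
      then show False using card_roots_of_power[OF False m] \<open>degree R < m\<close> by simp
    qed
    \<comment> \<open>The constant coefficient collects exactly the exponents j divisible by
      m.\<close>
    then have "coeff R 0 = 0" by simp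
    then have "X ^ q = (\<Sum>j\<le>J. if j mod m = 0 then coeff P j ^ q * s ^ (j div m) else 0)"
      by (simp add: R_def coeff_sum coeff_monom)
    then show ?thesis by (simp add: dvd_eq_mod_eq_0)
  qed
  with q show ?thesis by blast
qed

section \<open>Algebras of functions\<close>

inductive_set alg_gen :: "('v \<Rightarrow> 'k::comm_ring_1) set \<Rightarrow> ('v \<Rightarrow> 'k) set" for A where
  gen: "F \<in> A \<Longrightarrow> F \<in> alg_gen A"
| const: "(\<lambda>_. c) \<in> alg_gen A"
| add: "F \<in> alg_gen A \<Longrightarrow> G \<in> alg_gen A \<Longrightarrow> (\<lambda>v. F v + G v) \<in> alg_gen A"
| mult: "F \<in> alg_gen A \<Longrightarrow> G \<in> alg_gen A \<Longrightarrow> (\<lambda>v. F v * G v) \<in> alg_gen A"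

lemma alg_gen_closed:
  assumes "A \<subseteq> alg_gen B"
  shows "alg_gen A \<subseteq> alg_gen B"
proof
  fix F assume "F \<in> alg_gen A"
  then show "F \<in> alg_gen B" using assms
    by induction (auto intro: alg_gen.intros)
qed

lemma alg_gen_mono: "A \<subseteq> B \<Longrightarrow> alg_gen A \<subseteq> alg_gen B"
  by (intro alg_gen_closed) (auto intro: alg_gen.gen)

lemma alg_gen_sum:
  "(\<And>i. i \<in> I \<Longrightarrow> f i \<in> alg_gen A) \<Longrightarrow> (\<lambda>v. \<Sum>i\<in>I. f i v) \<in> alg_gen A"
  by (induction I rule: infinite_finite_induct) (auto intro: alg_gen.intros)

lemma alg_gen_power: "F \<in> alg_gen A \<Longrightarrow> (\<lambda>v. F v ^ q) \<in> alg_gen A"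
  by (induction q) (auto intro: alg_gen.intros)

lemma alg_gen_uminus: "F \<in> alg_gen A \<Longrightarrow> (\<lambda>v. - F v) \<in> alg_gen A"
  using alg_gen.mult[OF alg_gen.const[of "- 1"], of F A] by simp

lemma alg_gen_diff: "F \<in> alg_gen A \<Longrightarrow> G \<in> alg_gen A \<Longrightarrow> (\<lambda>v. F v - G v) \<in> alg_gen A"
  using alg_gen.add[OF _ alg_gen_uminus, of F A G] by simp

lemma alg_gen_shift:
  fixes u :: "'v::ab_group_add"
  assumes "\<And>F. F \<in> A \<Longrightarrow> (\<lambda>v. F (v + u)) \<in> alg_gen A" and "F \<in> alg_gen A"
  shows "(\<lambda>v. F (v + u)) \<in> alg_gen A"
  using assms(2) by induction (auto intro: assms(1) alg_gen.intros)

lemma alg_gen_finite_subset: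
  assumes "F \<in> alg_gen A"
  shows "\<exists>B. finite B \<and> B \<subseteq> A \<and> F \<in> alg_gen B"
  using assms
proof induction
  case (gen F)
  then show ?case by (intro exI[of _ "{F}"]) (auto intro: alg_gen.gen)
next
  case (const c)
  then show ?case by (intro exI[of _ "{}"]) (auto intro: alg_gen.const)
next
  case (add F G)
  then obtain B C where "finite B" "B \<subseteq> A" "F \<in> alg_gen B" "finite C" "C \<subseteq> A" "G \<in> alg_gen C" by blast
  then show ?case
    by (intro exI[of _ "B \<union> C"])
      (auto intro!: alg_gen.add intro: subsetD[OF alg_gen_mono[of B "B \<union> C"]] subsetD[OF alg_gen_mono[of C "B \<union> C"]])
next
  case (mult F G)
  then obtain B C where "finite B" "B \<subseteq> A" "F \<in> alg_gen B" "finite C" "C \<subseteq> A" "G \<in> alg_gen C" by blast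
  then show ?case
    by (intro exI[of _ "B \<union> C"])
      (auto intro!: alg_gen.mult intro: subsetD[OF alg_gen_mono[of B "B \<union> C"]] subsetD[OF alg_gen_mono[of C "B \<union> C"]])
qed

text \<open>Polynomials in one variable over the ring \<open>alg_gen A\<close>, encoded pointwise.\<close>

definition poly_family :: "('v \<Rightarrow> 'k::comm_ring_1) set \<Rightarrow> ('v \<Rightarrow> 'k poly) set" where
  "poly_family A = {P. (\<forall>j. (\<lambda>v. coeff (P v) j) \<in> alg_gen A) \<and> (\<exists>J. \<forall>v. degree (P v) \<le> J)}"

lemma poly_family_coeff: "P \<in> poly_family A \<Longrightarrow> (\<lambda>v. coeff (P v) j) \<in> alg_gen A"
  by (simp add: poly_family_def)

lemma poly_family_degree:
  assumes "P \<in> poly_family A"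
  obtains J where "\<And>v. degree (P v) \<le> J"
  using assms by (auto simp: poly_family_def)

lemma poly_family_const: "F \<in> alg_gen A \<Longrightarrow> (\<lambda>v. [:F v:]) \<in> poly_family A"
proof -
  assume "F \<in> alg_gen A"
  then have "(\<lambda>v. coeff [:F v:] j) \<in> alg_gen A" for j by (cases j) (auto intro: alg_gen.const)
  then show ?thesis by (auto simp: poly_family_def)
qed

lemma poly_family_var: "(\<lambda>v. [:0, 1:]) \<in> poly_family A"
  by (auto simp: poly_family_def intro!: exI[of _ 1] alg_gen.const)

lemma poly_family_add:
  assumes "P \<in> poly_family A" "Q \<in> poly_family A"
  shows "(\<lambda>v. P v + Q v) \<in> poly_family A"
proof -
  obtain J L where "\<And>v. degree (P v) \<le> J" "\<And>v. degree (Q v) \<le> L"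
    using poly_family_degree[OF assms(1)] poly_family_degree[OF assms(2)] by metis
  then have "degree (P v + Q v) \<le> max J L" for v
    by (meson degree_add_le max.cobounded1 max.cobounded2 order_trans)
  then show ?thesis using assms by (auto simp: poly_family_def intro!: alg_gen.add)
qed

lemma poly_family_mult:
  assumes "P \<in> poly_family A" "Q \<in> poly_family A"
  shows "(\<lambda>v. P v * Q v) \<in> poly_family A"
proof -
  obtain J L where "\<And>v. degree (P v) \<le> J" "\<And>v. degree (Q v) \<le> L"
    using poly_family_degree[OF assms(1)] poly_family_degree[OF assms(2)] by metis
  then have "degree (P v * Q v) \<le> J + L" for v
    by (meson add_mono degree_mult_le order_trans)
  then show ?thesis using assms
    by (auto simp: poly_family_def coeff_mult intro!: alg_gen_sum alg_gen.mult)
qed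

lemma poly_family_power: "P \<in> poly_family A \<Longrightarrow> (\<lambda>v. P v ^ q) \<in> poly_family A"
proof (induction q)
  case 0
  show ?case using poly_family_const[OF alg_gen.const[of 1]] by (simp add: one_pCons)
qed (simp add: poly_family_mult)

lemma poly_family_diff:
  assumes "P \<in> poly_family A" "Q \<in> poly_family A"
  shows "(\<lambda>v. P v - Q v) \<in> poly_family A"
proof -
  have "(\<lambda>v. [:- 1:] * Q v) \<in> poly_family A"
    using poly_family_const[OF alg_gen.const[of "- 1"]] assms(2) by (rule poly_family_mult)
  from poly_family_add[OF assms(1) this] show ?thesis by simp
qed

lemma poly_family_sum:
  assumes "finite I" "\<And>i. i \<in> I \<Longrightarrow> P i \<in> poly_family A"
  shows "(\<lambda>v. \<Sum>i\<in>I. P i v) \<in> poly_family A"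
  using assms
proof (induction I)
  case empty
  show ?case using poly_family_const[OF alg_gen.const[of 0]] by simp
qed (simp add: poly_family_add)

lemma alg_gen_insert_poly:
  assumes "G \<in> alg_gen (insert F A)"
  shows "\<exists>P\<in>poly_family A. \<forall>v. G v = poly (P v) (F v)"
  using assms
proof induction
  case (gen G)
  show ?case
  proof (cases "G = F")
    case True
    then show ?thesis using poly_family_var by (auto intro!: bexI[of _ "\<lambda>v. [:0, 1:]"])
  next
    case False
    then have "G \<in> alg_gen A" using gen by (auto intro: alg_gen.gen)
    then show ?thesis by (intro bexI[OF _ poly_family_const]) auto
  qed
next
  case (const c)
  show ?case by (intro bexI[OF _ poly_family_const[OF alg_gen.const[of c]]]) auto
next
  case (add G H)
  then obtain P Q where "P \<in> poly_family A" "Q \<in> poly_family A"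
    "\<forall>v. G v = poly (P v) (F v)" "\<forall>v. H v = poly (Q v) (F v)" by blast
  then show ?case by (intro bexI[OF _ poly_family_add[of P A Q]]) auto
next
  case (mult G H)
  then obtain P Q where "P \<in> poly_family A" "Q \<in> poly_family A"
    "\<forall>v. G v = poly (P v) (F v)" "\<forall>v. H v = poly (Q v) (F v)" by blast
  then show ?case by (intro bexI[OF _ poly_family_mult[of P A Q]]) auto
qed

text \<open>\<open>F\<close> is a root of the monic polynomial T^p - F^p over
  \<open>alg_gen A\<close>, so the exponents of \<open>F\<close> can be reduced modulo p.\<close>

lemma alg_gen_insert_power:
  fixes F :: "'v \<Rightarrow> 'k::field"
  assumes G: "G \<in> alg_gen (insert F A)" and p: "p > 0" and Fp: "(\<lambda>v. F v ^ p) \<in> alg_gen A"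
  shows "\<exists>c. (\<forall>i. c i \<in> alg_gen A) \<and> (\<forall>v. G v = (\<Sum>i<p. c i v * F v ^ i))"
proof -
  obtain P where P: "P \<in> poly_family A" "\<And>v. G v = poly (P v) (F v)"
    using alg_gen_insert_poly[OF G] by blast
  obtain J where J: "\<And>v. degree (P v) \<le> J" using poly_family_degree[OF P(1)] by blast
  define c where "c i v = (\<Sum>j | j \<in> {..J} \<and> j mod p = i. coeff (P v) j * (F v ^ p) ^ (j div p))" for i v
  have "c i \<in> alg_gen A" for i
    unfolding c_def
    by (intro alg_gen_sum alg_gen.mult poly_family_coeff[OF P(1)] alg_gen_power[OF Fp])
  moreover have "G v = (\<Sum>i<p. c i v * F v ^ i)" for v
  proof -
    have "(\<Sum>i<p. c i v * F v ^ i)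
        = (\<Sum>i<p. \<Sum>j | j \<in> {..J} \<and> j mod p = i. coeff (P v) j * (F v ^ p) ^ (j div p) * F v ^ (j mod p))"
      unfolding c_def sum_distrib_right by (intro sum.cong) auto
    also have "\<dots> = (\<Sum>j\<le>J. coeff (P v) j * (F v ^ p) ^ (j div p) * F v ^ (j mod p))"
      using p by (intro sum.group) auto
    also have "\<dots> = (\<Sum>j\<le>J. coeff (P v) j * F v ^ j)"
      unfolding power_mult[symmetric] mult.assoc power_add[symmetric] by simp
    also have "\<dots> = G v" using P(2) poly_sum_le[OF J] by simp
    finally show ?thesis by simp
  qed
  ultimately show ?thesis by blast
qed

inductive_set add_span :: "(nat \<Rightarrow> ('v \<Rightarrow> 'k::comm_ring_1) set) \<Rightarrow> ('v \<Rightarrow> 'k) set" for L where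
  base: "F \<in> L N \<Longrightarrow> F \<in> add_span L"
| add: "F \<in> add_span L \<Longrightarrow> G \<in> add_span L \<Longrightarrow> (\<lambda>v. F v + G v) \<in> add_span L"

lemma add_span_mono:
  assumes "\<And>N. L N \<subseteq> M N" shows "add_span L \<subseteq> add_span M"
proof
  fix F assume "F \<in> add_span L"
  then show "F \<in> add_span M" using assms by induction (auto intro: add_span.intros)
qed

lemma add_span_sum:
  assumes "(\<lambda>_. 0) \<in> L 0" "\<And>i. i \<in> I \<Longrightarrow> f i \<in> add_span L"
  shows "(\<lambda>v. \<Sum>i\<in>I. f i v) \<in> add_span L"
  using assms(2)
  by (induction I rule: infinite_finite_induct)
    (auto intro: add_span.base[where L = L, OF assms(1)] add_span.add)

text \<open>\<open>HP n\<close> stands for the homogeneous polynomial functions of degree \<open>n\<close> on the vector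
  space \<open>'v\<close>. All that matters is that they form a graded algebra of homogeneous functions which
  is stable under Taylor expansion.\<close>

locale polynomial_functions =
  fixes smul :: "'k::alg_closed_field \<Rightarrow> 'v::ab_group_add \<Rightarrow> 'v"
    and HP :: "nat \<Rightarrow> ('v \<Rightarrow> 'k) set"
  assumes smul_zero: "smul 0 v = 0"
    and smul_one: "smul 1 v = v"
    and HP_0_iff: "F \<in> HP 0 \<longleftrightarrow> (\<exists>c. F = (\<lambda>_. c))"
    and HP_zero: "(\<lambda>_. 0) \<in> HP n"
    and HP_add: "F \<in> HP n \<Longrightarrow> G \<in> HP n \<Longrightarrow> (\<lambda>v. F v + G v) \<in> HP n"
    and HP_mult: "F \<in> HP m \<Longrightarrow> G \<in> HP n \<Longrightarrow> (\<lambda>v. F v * G v) \<in> HP (m + n)"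
    and HP_homogeneous: "F \<in> HP n \<Longrightarrow> F (smul t v) = t ^ n * F v"
    and HP_expand: "F \<in> HP n \<Longrightarrow> \<exists>D. D 0 = F \<and> (\<forall>j\<le>n. D j \<in> HP (n - j)) \<and>
          (\<forall>v t. F (v + smul t e) = (\<Sum>j\<le>n. t ^ j * D j v))"
begin

section \<open>First consequences of homogeneity and Taylor expansion\<close>

lemma HP_scale: "F \<in> HP n \<Longrightarrow> (\<lambda>v. c * F v) \<in> HP n"
  using HP_mult[of "\<lambda>_. c" 0 F n] HP_0_iff by auto

lemma HP_const: "(\<lambda>_. c) \<in> HP 0"
  using HP_0_iff by blast

lemma HP_at_0: "F \<in> HP n \<Longrightarrow> n > 0 \<Longrightarrow> F 0 = 0"
  using HP_homogeneous[of F n 0 0] by (simp add: smul_zero power_0_left)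

lemma HP_power: "F \<in> HP n \<Longrightarrow> (\<lambda>v. F v ^ q) \<in> HP (q * n)"
  by (induction q) (auto intro: HP_const HP_mult)

lemma HP_diff: "F \<in> HP n \<Longrightarrow> G \<in> HP n \<Longrightarrow> (\<lambda>v. F v - G v) \<in> HP n"
  using HP_add[OF _ HP_scale[of G n "- 1"], of F] by simp

text \<open>The last coefficient has degree 0, so it is a constant. Taking v = 0 and t = 1
  identifies it as \<open>F e\<close>, because functions of positive degree vanish at 0. The mixed
  terms that remain have positive degree less than n.\<close>

lemma HP_expand_middle:
  assumes F: "F \<in> HP n" and n: "n > 0"
  obtains D where "\<And>j. j \<in> {1..<n} \<Longrightarrow> D j \<in> HP (n - j)"
    and "\<And>v t. F (v + smul t e) = F v + (\<Sum>j\<in>{1..<n}. t ^ j * D j v) + t ^ n * F e"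
proof -
  obtain D where D: "D 0 = F" "\<forall>j\<le>n. D j \<in> HP (n - j)"
    and eq: "\<And>v t. F (v + smul t e) = (\<Sum>j\<le>n. t ^ j * D j v)" using HP_expand[OF F] by blast
  have split: "{..n} = insert 0 (insert n {1..<n})" using n by auto
  have eq': "F (v + smul t e) = F v + (\<Sum>j\<in>{1..<n}. t ^ j * D j v) + t ^ n * D n v" for v t
    unfolding eq split using n by (simp add: D(1) add.assoc add.commute)
  have "D n \<in> HP 0" using D(2) by fastforce
  then obtain c where c: "D n = (\<lambda>_. c)" using HP_0_iff by auto
  have "(\<Sum>j\<in>{1..<n}. 1 ^ j * D j 0) = 0" using D(2) HP_at_0[of "D j" "n - j" for j] by (intro sum.neutral) auto
  then have "F e = c" using eq'[of 0 1] HP_at_0[OF F n] c by (simp add: smul_one)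
  then show thesis using that[of D] D(2) eq' c by auto
qed

section \<open>Polynomial functions and their filtration by degree\<close>

definition low :: "nat \<Rightarrow> ('v \<Rightarrow> 'k) set" where
  "low n = (\<Union>m<n. HP m)"

lemma low_mono: "m \<le> n \<Longrightarrow> low m \<subseteq> low n"
  by (force simp: low_def)

definition Pol :: "('v \<Rightarrow> 'k) set" where "Pol = add_span HP"

definition Pol_le :: "nat \<Rightarrow> ('v \<Rightarrow> 'k) set" where
  "Pol_le d = add_span (\<lambda>N. if N \<le> d then HP N else {\<lambda>_. 0})"

lemma Pol_le_mono: "d \<le> d' \<Longrightarrow> Pol_le d \<subseteq> Pol_le d'"
  unfolding Pol_le_def by (intro add_span_mono) (auto intro: HP_zero)

lemma Pol_le_exists: "F \<in> Pol \<Longrightarrow> \<exists>d. F \<in> Pol_le d"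
  unfolding Pol_def
proof (induction rule: add_span.induct)
  case (base F N)
  then show ?case by (intro exI[of _ N]) (auto simp: Pol_le_def intro!: add_span.base[of _ _ N])
next
  case (add F G)
  then obtain d d' where "F \<in> Pol_le d" "G \<in> Pol_le d'" by blast
  then have "F \<in> Pol_le (max d d')" "G \<in> Pol_le (max d d')"
    using Pol_le_mono[of d "max d d'"] Pol_le_mono[of d' "max d d'"] by auto
  then show ?case unfolding Pol_le_def by (blast intro: add_span.add)
qed

lemma Pol_le_0: "F \<in> Pol_le 0 \<Longrightarrow> \<exists>c. F = (\<lambda>_. c)"
  unfolding Pol_le_def
  by (induction rule: add_span.induct) (auto simp: HP_0_iff split: if_splits)

text \<open>In each homogeneous summand the top-degree part cancels. This drop of degree drives the
  descent in \<open>frobenius_independence\<close>.\<close>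

lemma Pol_le_difference:
  assumes "F \<in> Pol_le (Suc d)"
  shows "(\<lambda>v. F (v + u) - F v) \<in> Pol_le d"
  using assms unfolding Pol_le_def
proof (induction rule: add_span.induct)
  case (base F N)
  have zero: "(\<lambda>_. 0) \<in> (if 0 \<le> d then HP 0 else {\<lambda>_. 0})" by (simp add: HP_zero)
  show ?case
  proof (cases "N = 0 \<or> N > Suc d")
    case True
    then have "(\<lambda>v. F (v + u) - F v) = (\<lambda>_. 0)" using base HP_0_iff by auto
    then show ?thesis by (simp only:) (rule add_span.base[where N = 0], rule zero)
  next
    case False
    then have F: "F \<in> HP N" "N > 0" "N \<le> Suc d" using base by auto
    obtain D where D: "\<And>j. j \<in> {1..<N} \<Longrightarrow> D j \<in> HP (N - j)"
      and eq: "\<And>v t. F (v + smul t u) = F v + (\<Sum>j\<in>{1..<N}. t ^ j * D j v) + t ^ N * F u"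
      using HP_expand_middle[OF F(1,2)] by blast
    have "(\<lambda>v. F (v + u) - F v) = (\<lambda>v. (\<Sum>j\<in>{1..<N}. D j v) + F u)"
      using eq[of _ 1] by (auto simp: smul_one)
    moreover have "D j \<in> add_span (\<lambda>N. if N \<le> d then HP N else {\<lambda>_. 0})" if "j \<in> {1..<N}" for j
      using D[OF that] that F(3) by (intro add_span.base[where N = "N - j"]) auto
    moreover have "(\<lambda>_. F u) \<in> add_span (\<lambda>N. if N \<le> d then HP N else {\<lambda>_. 0})"
      using HP_const by (intro add_span.base[where N = 0]) auto
    ultimately show ?thesis by (auto intro!: add_span.add add_span_sum zero)
  qed
next
  case (add F G)
  have "(\<lambda>v. F (v + u) + G (v + u) - (F v + G v))
      = (\<lambda>v. (F (v + u) - F v) + (G (v + u) - G v))" by auto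
  then show ?case using add_span.add[OF add.IH] by simp
qed

lemma Pol_add: "F \<in> Pol \<Longrightarrow> G \<in> Pol \<Longrightarrow> (\<lambda>v. F v + G v) \<in> Pol"
  unfolding Pol_def by (rule add_span.add)

lemma Pol_HP: "F \<in> HP n \<Longrightarrow> F \<in> Pol"
  unfolding Pol_def by (rule add_span.base)

lemma Pol_shift: "F \<in> Pol \<Longrightarrow> (\<lambda>v. F (v + u)) \<in> Pol"
proof -
  assume F: "F \<in> Pol"
  then obtain d where "F \<in> Pol_le d" using Pol_le_exists by blast
  then have "F \<in> Pol_le (Suc d)" using Pol_le_mono[of d "Suc d"] by auto
  then have "(\<lambda>v. F (v + u) - F v) \<in> Pol_le d" by (rule Pol_le_difference)
  then have "(\<lambda>v. F (v + u) - F v) \<in> Pol"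
    unfolding Pol_le_def Pol_def
    by (rule subsetD[OF add_span_mono, rotated]) (auto intro: HP_zero)
  from Pol_add[OF this F] show ?thesis by simp
qed

section \<open>Finite strength and homogeneous components\<close>

text \<open>\<open>F \<in> dec n {}\<close> means that \<open>F\<close> has finite strength, and \<open>F \<in> dec n S\<close> that some
  linear combination \<open>F - \<Sum> a\<^sub>i s\<^sub>i\<close> with \<open>s\<^sub>i \<in> S\<close> has.\<close>

inductive_set dec :: "nat \<Rightarrow> ('v \<Rightarrow> 'k) set \<Rightarrow> ('v \<Rightarrow> 'k) set" for n S where
  zero: "(\<lambda>_. 0) \<in> dec n S"
| base: "F \<in> S \<Longrightarrow> F \<in> dec n S"
| prod: "G \<in> HP a \<Longrightarrow> H \<in> HP b \<Longrightarrow> 0 < a \<Longrightarrow> 0 < b \<Longrightarrow> a + b = n \<Longrightarrow> (\<lambda>v. G v * H v) \<in> dec n S"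
| add: "F \<in> dec n S \<Longrightarrow> G \<in> dec n S \<Longrightarrow> (\<lambda>v. F v + G v) \<in> dec n S"
| scale: "F \<in> dec n S \<Longrightarrow> (\<lambda>v. c * F v) \<in> dec n S"

lemma dec_mono: "S \<subseteq> T \<Longrightarrow> dec n S \<subseteq> dec n T"
proof
  fix F assume "S \<subseteq> T" "F \<in> dec n S"
  from this(2,1) show "F \<in> dec n T" by induction (auto intro: dec.intros)
qed

lemma dec_subset_HP:
  assumes "S \<subseteq> HP n" shows "dec n S \<subseteq> HP n"
proof
  fix F assume "F \<in> dec n S"
  then show "F \<in> HP n" using assms
    by induction (auto intro: HP_zero HP_add HP_scale HP_mult)
qed

text \<open>\<open>K\<close> collects the factors of all products that occur in a derivation of
  \<open>F\<close>. They carry their degrees along, so that they can be added to a system of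
  equations.\<close>

lemma dec_finite_support:
  assumes "F \<in> dec n S"
  shows "\<exists>K :: (nat \<times> ('v \<Rightarrow> 'k)) multiset.
    (\<forall>(m, G)\<in>#K. 0 < m \<and> m < n \<and> G \<in> HP m) \<and> F \<in> alg_gen (S \<union> snd ` set_mset K) \<and>
    (\<forall>v. (\<forall>G\<in>S. G v = 0) \<longrightarrow> (\<forall>(m, G)\<in>#K. G v = 0) \<longrightarrow> F v = 0)"
  using assms
proof induction
  case zero
  show ?case by (intro exI[of _ "{#}"]) (auto intro: alg_gen.const)
next
  case (base F)
  then show ?case by (intro exI[of _ "{#}"]) (auto intro: alg_gen.gen)
next
  case (prod G a H b)
  then show ?case by (intro exI[of _ "{#(a, G), (b, H)#}"]) (auto intro: alg_gen.mult[OF alg_gen.gen alg_gen.gen])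
next
  case (add F G)
  obtain K where K: "\<forall>(m, G)\<in>#K. 0 < m \<and> m < n \<and> G \<in> HP m" "F \<in> alg_gen (S \<union> snd ` set_mset K)"
    "\<forall>v. (\<forall>G\<in>S. G v = 0) \<longrightarrow> (\<forall>(m, G)\<in>#K. G v = 0) \<longrightarrow> F v = 0" using add.IH(1) by blast
  obtain L where L: "\<forall>(m, G)\<in>#L. 0 < m \<and> m < n \<and> G \<in> HP m" "G \<in> alg_gen (S \<union> snd ` set_mset L)"
    "\<forall>v. (\<forall>G\<in>S. G v = 0) \<longrightarrow> (\<forall>(m, G)\<in>#L. G v = 0) \<longrightarrow> G v = 0" using add.IH(2) by blast
  have "F \<in> alg_gen (S \<union> snd ` set_mset (K + L))" "G \<in> alg_gen (S \<union> snd ` set_mset (K + L))"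
    using K(2) L(2) by (auto elim!: subsetD[OF alg_gen_mono, rotated])
  then show ?case using K(1,3) L(1,3)
    by (intro exI[of _ "K + L"] conjI alg_gen.add) (auto dest!: spec)
next
  case (scale F c)
  then obtain K where K: "\<forall>(m, G)\<in>#K. 0 < m \<and> m < n \<and> G \<in> HP m" "F \<in> alg_gen (S \<union> snd ` set_mset K)"
    "\<forall>v. (\<forall>G\<in>S. G v = 0) \<longrightarrow> (\<forall>(m, G)\<in>#K. G v = 0) \<longrightarrow> F v = 0" by blast
  then show ?case by (intro exI[of _ K] conjI alg_gen.mult alg_gen.const) auto
qed

text \<open>Polynomial functions whose component of degree \<open>n\<close> lies in \<open>dec n S\<close>.\<close>

definition Pol_dec :: "nat \<Rightarrow> ('v \<Rightarrow> 'k) set \<Rightarrow> ('v \<Rightarrow> 'k) set" where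
  "Pol_dec n S = add_span (\<lambda>N. if N = n then dec n S else HP N)"

lemma Pol_dec_add: "F \<in> Pol_dec n S \<Longrightarrow> G \<in> Pol_dec n S \<Longrightarrow> (\<lambda>v. F v + G v) \<in> Pol_dec n S"
  unfolding Pol_dec_def by (rule add_span.add)

lemma Pol_dec_base: "F \<in> HP N \<Longrightarrow> (N = n \<Longrightarrow> F \<in> dec n S) \<Longrightarrow> F \<in> Pol_dec n S"
  unfolding Pol_dec_def by (rule add_span.base[where N = N]) auto

text \<open>When the degrees of two components add up to n, either one factor is constant and the
  product is a multiple of an element of \<open>dec n S\<close>, or both degrees are positive and
  the product is a generator of \<open>dec n S\<close>.\<close>

lemma Pol_dec_mult:
  assumes n: "n > 0" and S: "S \<subseteq> HP n" and F: "F \<in> Pol_dec n S" and G: "G \<in> Pol_dec n S"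
  shows "(\<lambda>v. F v * G v) \<in> Pol_dec n S"
  using F unfolding Pol_dec_def[of n S]
proof (induction rule: add_span.induct)
  case (base F N)
  then have F: "F \<in> HP N" "N = n \<Longrightarrow> F \<in> dec n S"
    using dec_subset_HP[OF S] by (auto split: if_splits)
  show ?case using G unfolding Pol_dec_def[of n S]
  proof (induction rule: add_span.induct)
    case (base G M)
    then have G: "G \<in> HP M" "M = n \<Longrightarrow> G \<in> dec n S"
      using dec_subset_HP[OF S] by (auto split: if_splits)
    have "(\<lambda>v. F v * G v) \<in> dec n S" if "N + M = n"
    proof -
      consider "N = 0" | "M = 0" | "N > 0" "M > 0" by blast
      then show ?thesis
      proof cases
        case 1
        then obtain c where "F = (\<lambda>_. c)" using F(1) HP_0_iff by auto
        then show ?thesis using 1 that G(2) by (auto intro: dec.scale)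
      next
        case 2
        then obtain c where "G = (\<lambda>_. c)" using G(1) HP_0_iff by auto
        then show ?thesis using 2 that F(2) dec.scale[of F n S c] by (simp add: mult.commute)
      next
        case 3
        then show ?thesis using F G that by (auto intro: dec.prod)
      qed
    qed
    then show ?case using HP_mult[OF F(1) G(1)] by (intro add_span.base[where N = "N + M"]) auto
  next
    case (add G H)
    then show ?case using add_span.add[OF add.IH] by (simp add: algebra_simps)
  qed
next
  case (add F F')
  then show ?case using add_span.add[OF add.IH] by (simp add: algebra_simps)
qed

lemma alg_gen_subset_Pol_dec:
  assumes "n > 0" "S \<subseteq> HP n" "A \<subseteq> Pol_dec n S"
  shows "alg_gen A \<subseteq> Pol_dec n S"
proof
  fix F assume "F \<in> alg_gen A"
  then show "F \<in> Pol_dec n S"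
    using assms
    by induction (auto intro: Pol_dec_add Pol_dec_mult Pol_dec_base[OF HP_const])
qed

text \<open>The identity is claimed for every bound from \<open>d\<close> on, so that two
  decompositions can be added up to the larger of their bounds.\<close>

lemma Pol_dec_components:
  assumes "F \<in> Pol_dec n S" and S: "S \<subseteq> HP n"
  shows "\<exists>c d. (\<forall>N. c N \<in> HP N) \<and> c n \<in> dec n S \<and> n \<le> d \<and> (\<forall>N>d. c N = (\<lambda>_. 0)) \<and>
    (\<forall>d'\<ge>d. \<forall>v. F v = (\<Sum>N\<le>d'. c N v))"
  using assms(1) unfolding Pol_dec_def
proof (induction rule: add_span.induct)
  case (base F N)
  then have F: "F \<in> HP N" "N = n \<Longrightarrow> F \<in> dec n S"
    using dec_subset_HP[OF S] by (auto split: if_splits)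
  have "(\<Sum>M\<le>d'. (if M = N then F else (\<lambda>_. 0)) v) = F v" if "max n N \<le> d'" for d' v
  proof -
    have "(\<Sum>M\<le>d'. (if M = N then F else (\<lambda>_. 0)) v) = (\<Sum>M\<le>d'. if M = N then F v else 0)"
      by (intro sum.cong) auto
    then show ?thesis using that by simp
  qed
  then show ?case using F
    by (intro exI[of _ "\<lambda>M. if M = N then F else (\<lambda>_. 0)"] exI[of _ "max n N"])
      (auto intro: HP_zero dec.zero)
next
  case (add F G)
  obtain c d where c: "\<forall>N. c N \<in> HP N" "c n \<in> dec n S" "n \<le> d" "\<forall>N>d. c N = (\<lambda>_. 0)"
    "\<forall>d'\<ge>d. \<forall>v. F v = (\<Sum>N\<le>d'. c N v)" using add.IH(1) by blast
  obtain c' d' where c': "\<forall>N. c' N \<in> HP N" "c' n \<in> dec n S" "n \<le> d'" "\<forall>N>d'. c' N = (\<lambda>_. 0)"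
    "\<forall>d''\<ge>d'. \<forall>v. G v = (\<Sum>N\<le>d''. c' N v)" using add.IH(2) by blast
  show ?case using c c'
    by (intro exI[of _ "\<lambda>N v. c N v + c' N v"] exI[of _ "max d d'"])
      (auto intro: HP_add dec.add simp: sum.distrib)
qed

lemma Pol_dec_homogeneous:
  assumes "F \<in> Pol_dec n S" and S: "S \<subseteq> HP n" and F: "F \<in> HP n"
  shows "F \<in> dec n S"
proof -
  obtain c d where c: "\<And>N. c N \<in> HP N" "c n \<in> dec n S" "n \<le> d"
    and eq: "\<And>v. F v = (\<Sum>N\<le>d. c N v)" using Pol_dec_components[OF assms(1) S] by blast
  have "F v = c n v" for v
  proof -
    \<comment> \<open>On the line through v, the component of degree N contributes the multiple t^N
      of its value. As \<open>'k\<close> is infinite, the coefficients of t^n can be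
      compared.\<close>
    define P where "P = (\<Sum>N\<le>d. monom (c N v) N) - monom (F v) n"
    have "poly P t = 0" for t
      using eq[of "smul t v"] HP_homogeneous[OF c(1)] HP_homogeneous[OF F]
      by (simp add: P_def poly_sum poly_monom mult.commute)
    then have "P = 0" by (rule poly_eq_0_of_values)
    then have "coeff P n = 0" by simp
    then show ?thesis using c(3) by (simp add: P_def coeff_sum)
  qed
  then have "F = c n" by auto
  then show ?thesis using c(2) by simp
qed

lemma HP_difference_low:
  assumes F: "F \<in> HP n"
  shows "(\<lambda>v. F (v + u) - F v) \<in> alg_gen (low n)"
proof (cases "n = 0")
  case True
  then have "(\<lambda>v. F (v + u) - F v) = (\<lambda>_. 0)" using F HP_0_iff by auto
  then show ?thesis using alg_gen.const[of 0] by simp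
next
  case False
  then obtain D where D: "\<And>j. j \<in> {1..<n} \<Longrightarrow> D j \<in> HP (n - j)"
    and eq: "\<And>v t. F (v + smul t u) = F v + (\<Sum>j\<in>{1..<n}. t ^ j * D j v) + t ^ n * F u"
    using HP_expand_middle[OF F] by blast
  have "D j \<in> low n" if "j \<in> {1..<n}" for j using D[OF that] that by (force simp: low_def)
  then have "(\<lambda>v. (\<Sum>j\<in>{1..<n}. D j v) + F u) \<in> alg_gen (low n)"
    by (intro alg_gen.add alg_gen_sum alg_gen.const alg_gen.gen)
  moreover have "(\<lambda>v. F (v + u) - F v) = (\<lambda>v. (\<Sum>j\<in>{1..<n}. D j v) + F u)"
    using eq[of _ 1] by (auto simp: smul_one)
  ultimately show ?thesis by simp
qed

subsection \<open>Independence over p-th powers\<close>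

definition frob :: "('v \<Rightarrow> 'k) set" where
  "frob = {(\<lambda>v. F v ^ CHAR('k)) | F. F \<in> Pol}"

lemma low_subset_Pol_dec: "low n \<subseteq> Pol_dec n S"
  by (auto simp: low_def intro: Pol_dec_base)

text \<open>Since p is at least 2, F^p = F * F^(p-1) is a product of two factors of positive degree
  whenever its degree is n. Sums are covered because the p-th power is additive.\<close>

lemma frob_subset_Pol_dec:
  assumes prime: "prime CHAR('k)" and n: "n > 0"
  shows "frob \<subseteq> Pol_dec n S"
proof -
  have "(\<lambda>v. F v ^ CHAR('k)) \<in> Pol_dec n S" if "F \<in> Pol" for F
    using that unfolding Pol_def
  proof (induction rule: add_span.induct)
    case (base F N)
    have "(\<lambda>v. F v ^ CHAR('k)) \<in> dec n S" if eq: "CHAR('k) * N = n"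
    proof -
      obtain c where c: "CHAR('k) = Suc (Suc c)"
        using prime_ge_2_nat[OF prime] by (metis add_2_eq_Suc le_Suc_ex)
      have "F \<in> HP N" "(\<lambda>v. F v ^ Suc c) \<in> HP (Suc c * N)" using base HP_power by blast+
      then have "(\<lambda>v. F v * F v ^ Suc c) \<in> dec n S"
        by (rule dec.prod) (use eq n c in auto)
      then show ?thesis by (simp add: c)
    qed
    with HP_power[OF base] show ?case by (rule Pol_dec_base)
  next
    case (add F G)
    then show ?case using Pol_dec_add freshmans_dream[OF prime] by simp
  qed
  then show ?thesis by (auto simp: frob_def)
qed

lemma Pol_dec_subset_Pol: "S \<subseteq> HP n \<Longrightarrow> Pol_dec n S \<subseteq> Pol"
  unfolding Pol_dec_def Pol_def using dec_subset_HP by (intro add_span_mono) auto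

text \<open>If \<open>x\<close> has degree \<open>n\<close> and is not in \<open>dec n S\<close>, then \<open>1, x, \<dots>, x^(p-1)\<close> are linearly
  independent over the algebra \<open>R\<close> generated by all \<open>p\<close>-th powers, everything of degree below
  \<open>n\<close>, and \<open>S\<close>. As \<open>R\<close> is stable under translations, one can subtract from a relation its
  translates; in a minimal relation this makes the leading coefficient constant and then
  exhibits \<open>x\<close> as an element of \<open>R\<close>.\<close>

lemma frobenius_independence:
  assumes prime: "prime CHAR('k)" and n: "n > 0" and S: "S \<subseteq> HP n"
    and x: "x \<in> HP n" and x_notin: "x \<notin> dec n S"
    and R_def: "R = alg_gen (frob \<union> low n \<union> S)"
    and "N < CHAR('k)" and "\<And>j. j \<le> N \<Longrightarrow> m j \<in> R"
    and "\<And>v. (\<Sum>j\<le>N. m j v * x v ^ j) = 0" and "j \<le> N"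
  shows "m j = (\<lambda>_. 0)"
proof -
  have R_sub: "R \<subseteq> Pol_dec n S"
    unfolding R_def using frob_subset_Pol_dec[OF prime n] low_subset_Pol_dec S
    by (intro alg_gen_subset_Pol_dec n S) (auto intro: Pol_dec_base dec.base)
  then have R_Pol: "R \<subseteq> Pol" using Pol_dec_subset_Pol[OF S] by blast
  \<comment> \<open>The component of degree n of any element of \<open>R\<close> lies in
    \<open>dec n S\<close>, and \<open>x\<close> is its own such component.\<close>
  have x_R: "x \<notin> R" using R_sub Pol_dec_homogeneous[OF _ S x] x_notin by blast
  have low_R: "alg_gen (low n) \<subseteq> R" unfolding R_def by (rule alg_gen_mono) auto
  have shift_R: "(\<lambda>v. F (v + u)) \<in> R" if "F \<in> R" for F u
    unfolding R_def
  proof (rule alg_gen_shift)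
    show "F \<in> alg_gen (frob \<union> low n \<union> S)" using that R_def by simp
    fix G assume "G \<in> frob \<union> low n \<union> S"
    then consider z where "G = (\<lambda>v. z v ^ CHAR('k))" "z \<in> Pol" | "G \<in> low n" | "G \<in> S"
      by (auto simp: frob_def)
    then show "(\<lambda>v. G (v + u)) \<in> alg_gen (frob \<union> low n \<union> S)"
    proof cases
      case 1
      then show ?thesis using Pol_shift[of z u] by (intro alg_gen.gen) (auto simp: frob_def)
    next
      case 2
      then obtain k where k: "k < n" "G \<in> HP k" by (auto simp: low_def)
      have "(\<lambda>v. G (v + u) - G v) \<in> R"
        using HP_difference_low[OF k(2)] low_R alg_gen_mono[OF low_mono[of k n]] k(1) by auto
      moreover have "G \<in> R" using 2 by (auto simp: R_def intro: alg_gen.gen)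
      ultimately show ?thesis using alg_gen.add[of _ "frob \<union> low n \<union> S" G] by (fastforce simp: R_def)
    next
      case 3
      have "(\<lambda>v. G (v + u) - G v) \<in> R"
        using HP_difference_low[of G n] low_R S 3 by auto
      moreover have "G \<in> R" using 3 by (auto simp: R_def intro: alg_gen.gen)
      ultimately show ?thesis using alg_gen.add[of _ "frob \<union> low n \<union> S" G] by (fastforce simp: R_def)
    qed
  qed
  show ?thesis using assms(7-10)
  proof (induction N arbitrary: m j rule: less_induct)
    case (less N)
    \<comment> \<open>Translate the relation by u, expand the powers of x(v + u) = x(v) + (x(v + u)
      - x(v)), whose second summand lies in \<open>R\<close>, and subtract the original relation.
      \<open>M m u i\<close> is the resulting coefficient of x^i.\<close>
    define M where "M m u i v = (\<Sum>j\<le>N. of_nat (j choose i) * m j (v + u) * (x (v + u) - x v) ^ (j - i)) - m i v"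
      for m :: "nat \<Rightarrow> 'v \<Rightarrow> 'k" and u i v
    have M_R: "M m u i \<in> R" if m: "\<And>j. j \<le> N \<Longrightarrow> m j \<in> R" and i: "i \<le> N" for m u i
    proof -
      have "(\<lambda>v. x (v + u) - x v) \<in> R" using HP_difference_low[OF x] low_R by blast
      then have "(\<lambda>v. \<Sum>j\<le>N. of_nat (j choose i) * m j (v + u) * (x (v + u) - x v) ^ (j - i)) \<in> R"
        using shift_R[OF m] unfolding R_def
        by (intro alg_gen_sum alg_gen.mult alg_gen_power alg_gen.const) auto
      then show ?thesis using m[OF i] unfolding M_def R_def by (rule alg_gen_diff)
    qed
    have M_rel: "(\<Sum>i\<le>N. M m u i v * x v ^ i) = 0"
      if rel: "\<And>v. (\<Sum>j\<le>N. m j v * x v ^ j) = 0" for m u v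
    proof -
      define a where "a = x (v + u) - x v"
      have binom: "x (v + u) ^ j = (\<Sum>i\<le>N. of_nat (j choose i) * x v ^ i * a ^ (j - i))" if "j \<le> N" for j
      proof -
        have "x (v + u) ^ j = (x v + a) ^ j" by (simp add: a_def)
        also have "\<dots> = (\<Sum>i\<le>j. of_nat (j choose i) * x v ^ i * a ^ (j - i))" by (rule binomial_ring)
        also have "\<dots> = (\<Sum>i\<le>N. of_nat (j choose i) * x v ^ i * a ^ (j - i))"
          using that by (intro sum.mono_neutral_left) (auto simp: binomial_eq_0)
        finally show ?thesis .
      qed
      have "(\<Sum>i\<le>N. (\<Sum>j\<le>N. of_nat (j choose i) * m j (v + u) * a ^ (j - i)) * x v ^ i)
          = (\<Sum>j\<le>N. \<Sum>i\<le>N. of_nat (j choose i) * m j (v + u) * a ^ (j - i) * x v ^ i)"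
        unfolding sum_distrib_right by (rule sum.swap)
      also have "\<dots> = (\<Sum>j\<le>N. m j (v + u) * x (v + u) ^ j)"
        by (intro sum.cong refl) (simp add: binom sum_distrib_left mult_ac)
      also have "\<dots> = 0" by (rule rel)
      finally show ?thesis using rel[of v]
        by (simp add: M_def a_def[symmetric] left_diff_distrib sum_subtractf)
    qed
    have M_lead: "M m u N v = m N (v + u) - m N v" for m u v
    proof -
      have "(\<Sum>j\<le>N. of_nat (j choose N) * m j (v + u) * (x (v + u) - x v) ^ (j - N))
          = (\<Sum>j\<le>N. if j = N then m N (v + u) else 0)"
        by (intro sum.cong) (auto simp: binomial_eq_0)
      then show ?thesis by (simp add: M_def)
    qed
    \<comment> \<open>Inner induction on the degree of the leading coefficient: that of
      \<open>M m u\<close> is a difference of translates and has smaller degree. So it vanishes for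
      every u, which makes \<open>m N\<close> translation invariant and hence constant.\<close>
    have lead: "m N = (\<lambda>_. 0)"
      if "m N \<in> Pol_le d" and m: "\<And>j. j \<le> N \<Longrightarrow> m j \<in> R"
        and rel: "\<And>v. (\<Sum>j\<le>N. m j v * x v ^ j) = 0" for m d
      using that
    proof (induction d arbitrary: m rule: less_induct)
      case (less d m)
      have M_in: "M m u j \<in> R" if "j \<le> N" for u j
        by (rule M_R) (use less.prems(2) that in auto)
      have M_N: "M m u N = (\<lambda>_. 0)" for u
      proof (cases d)
        case 0
        then obtain c where "m N = (\<lambda>_. c)" using less.prems(1) Pol_le_0 by blast
        then show ?thesis using M_lead by auto
      next
        case (Suc d')
        have "M m u N = (\<lambda>v. m N (v + u) - m N v)" using M_lead by blast
        then have "M m u N \<in> Pol_le d'"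
          using Pol_le_difference[of "m N" d' u] less.prems(1) Suc by simp
        then show ?thesis
          using less.IH[of d' "M m u"] Suc M_in M_rel[OF less.prems(3)] by blast
      qed
      then have inv: "m N (v + u) = m N v" for u v using M_lead[of m u v] by simp
      define c where "c = m N 0"
      have c: "m N v = c" for v using inv[of 0 v] by (simp add: c_def)
      show ?case
      proof (cases N)
        case 0
        then show ?thesis using less.prems(3) by auto
      next
        case (Suc N')
        \<comment> \<open>Otherwise each \<open>M m u\<close> is a relation of length N - 1 and is
          trivial by the outer induction. Its coefficient of index N - 1 then says that m_(N-1) + N
          c x is translation invariant, hence constant. As 0 < N < p, the factor N is invertible and
          \<open>x\<close> would lie in \<open>R\<close>.\<close>
        have "c = 0"
        proof (rule ccontr)
          assume "c \<noteq> 0"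
          have M_N': "M m u N' = (\<lambda>_. 0)" for u
          proof (rule \<open>\<And>y m j. y < N \<Longrightarrow> y < CHAR('k) \<Longrightarrow> (\<And>j. j \<le> y \<Longrightarrow> m j \<in> R) \<Longrightarrow>
              (\<And>v. (\<Sum>j\<le>y. m j v * x v ^ j) = 0) \<Longrightarrow> j \<le> y \<Longrightarrow> m j = (\<lambda>_. 0)\<close>[of N'])
            show "N' < N" "N' < CHAR('k)" using Suc \<open>N < CHAR('k)\<close> by auto
            show "M m u i \<in> R" if "i \<le> N'" for i using M_in that Suc by simp
            show "(\<Sum>i\<le>N'. M m u i v * x v ^ i) = 0" for v
              using M_rel[OF less.prems(3), of u v] M_N[of u] Suc by simp
          qed simp
          have "m N' (v + u) + of_nat N * c * x (v + u) = m N' v + of_nat N * c * x v" for u v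
          proof -
            have "(\<Sum>j\<le>N. of_nat (j choose N') * m j (v + u) * (x (v + u) - x v) ^ (j - N'))
                = (\<Sum>j\<in>{N', N}. of_nat (j choose N') * m j (v + u) * (x (v + u) - x v) ^ (j - N'))"
              using Suc by (intro sum.mono_neutral_right) (auto simp: binomial_eq_0)
            also have "\<dots> = m N' (v + u) + of_nat N * c * (x (v + u) - x v)"
              using Suc c by simp
            finally show ?thesis using fun_cong[OF M_N'[of u], of v] by (simp add: M_def algebra_simps)
          qed
          from this[of 0] have g: "m N' u + of_nat N * c * x u = m N' 0 + of_nat N * c * x 0" for u by simp
          have "of_nat N \<noteq> (0::'k)"
            using \<open>N < CHAR('k)\<close> Suc nat_dvd_not_less[of N "CHAR('k)"]
            unfolding of_nat_eq_0_iff_char_dvd by simp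
          then have "x = (\<lambda>u. inverse (of_nat N * c) * ((m N' 0 + of_nat N * c * x 0) - m N' u))"
            using g \<open>c \<noteq> 0\<close> by (auto simp: fun_eq_iff field_simps)
          moreover have "(\<lambda>u. inverse (of_nat N * c) * ((m N' 0 + of_nat N * c * x 0) - m N' u)) \<in> R"
            using less.prems(2)[of N'] Suc unfolding R_def
            by (intro alg_gen.mult alg_gen_diff alg_gen.const) auto
          ultimately show False using x_R by simp
        qed
        then show ?thesis using c by auto
      qed
    qed
    obtain d where "m N \<in> Pol_le d" using less.prems(2)[of N] R_Pol Pol_le_exists by blast
    then have mN: "m N = (\<lambda>_. 0)" using lead less.prems(2,3) by blast
    show ?case
    proof (cases "j = N")
      case False
      then obtain N' where N': "N = Suc N'" "j \<le> N'" using less.prems(4) by (cases N) auto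
      show ?thesis
      proof (rule less.IH[of N'])
        show "(\<Sum>j\<le>N'. m j v * x v ^ j) = 0" for v using less.prems(3)[of v] mN N' by simp
      qed (use N' less.prems in auto)
    qed (use mN in simp)
  qed
qed

subsection \<open>Elimination\<close>

text \<open>The degree is recorded next to each equation because a function need not determine it: 0
  belongs to every \<open>HP n\<close>. Multisets are used for the sake of the termination
  order.\<close>

definition valid :: "(nat \<times> ('v \<Rightarrow> 'k)) multiset \<Rightarrow> bool" where
  "valid Y \<longleftrightarrow> (\<forall>(n, F)\<in>#Y. 0 < n \<and> F \<in> HP n)"

definition zeros :: "(nat \<times> ('v \<Rightarrow> 'k)) multiset \<Rightarrow> 'v set" where
  "zeros Y = {v. \<forall>(n, F)\<in>#Y. F v = 0}"

definition of_degree :: "nat \<Rightarrow> (nat \<times> ('v \<Rightarrow> 'k)) multiset \<Rightarrow> ('v \<Rightarrow> 'k) set" where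
  "of_degree n Y = {F. (n, F) \<in># Y}"

lemma valid_simps [simp]:
  "valid {#}" "valid (add_mset (n, F) Y) \<longleftrightarrow> 0 < n \<and> F \<in> HP n \<and> valid Y"
  "valid (Y + K) \<longleftrightarrow> valid Y \<and> valid K"
  by (auto simp: valid_def)

lemma zeros_simps [simp]:
  "zeros {#} = UNIV" "zeros (add_mset (n, F) Y) = {v. F v = 0} \<inter> zeros Y"
  "zeros (Y + K) = zeros Y \<inter> zeros K"
  by (auto simp: zeros_def)

lemma of_degree_subset_HP: "valid Y \<Longrightarrow> of_degree n Y \<subseteq> HP n"
  by (auto simp: valid_def of_degree_def)

text \<open>Replacing an equation of maximal degree by finitely many of smaller degree terminates, by
  well-foundedness of the multiset order on the degrees.\<close>

lemma system_induct [consumes 1, case_names empty step]: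
  assumes "valid Y" and "P {#}"
    and step: "\<And>d F Y. valid Y \<Longrightarrow> 0 < d \<Longrightarrow> F \<in> HP d \<Longrightarrow> (\<And>m G. (m, G) \<in># Y \<Longrightarrow> m \<le> d)
      \<Longrightarrow> (\<And>K. valid K \<Longrightarrow> (\<And>m G. (m, G) \<in># K \<Longrightarrow> m < d) \<Longrightarrow> P (Y + K)) \<Longrightarrow> P (add_mset (d, F) Y)"
  shows "P Y"
proof -
  have "wf (inv_image (mult less_than) (image_mset fst) :: ((nat \<times> ('v \<Rightarrow> 'k)) multiset \<times> _) set)"
    by (intro wf_inv_image wf_mult wf_less_than)
  then show ?thesis using assms(1)
  proof (induction Y rule: wf_induct_rule)
    case (less Y)
    show ?case
    proof (cases "Y = {#}")
      case False
      define d where "d = Max (fst ` set_mset Y)"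
      have "d \<in> fst ` set_mset Y" unfolding d_def using False by (intro Max_in) auto
      then obtain F where "(d, F) \<in># Y" by auto
      then obtain Z where Z: "Y = add_mset (d, F) Z" by (metis insert_DiffM)
      have max: "m \<le> d" if "(m, G) \<in># Y" for m G
        unfolding d_def using that by (intro Max_ge) force+
      show ?thesis unfolding Z
      proof (rule step)
        fix K assume K: "valid K" "\<And>m G. (m, G) \<in># K \<Longrightarrow> m < d"
        have "(image_mset fst Z + image_mset fst K, image_mset fst Z + {#d#}) \<in> mult less_than"
          using K(2) by (intro one_step_implies_mult) auto
        then show "P (Z + K)" using less.prems Z K(1) by (intro less.IH) auto
      qed (use less.prems Z max in auto)
    qed (use assms(2) in simp)
  qed
qed

text \<open>The equation \<open>F\<close> is traded for the factors in an expression of it.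
  \<open>char_root_in_alg_gen_low\<close> needs that \<open>F\<close> is still a polynomial in the
  new system, \<open>vanishing\<close> that no new zeros appear.\<close>

lemma dec_eliminate:
  assumes "F \<in> dec d (of_degree d Y)"
  shows "\<exists>K. valid K \<and> (\<forall>m G. (m, G) \<in># K \<longrightarrow> m < d) \<and>
    F \<in> alg_gen (snd ` set_mset (Y + K)) \<and> zeros (Y + K) \<subseteq> zeros (add_mset (d, F) Y)"
proof -
  from dec_finite_support[OF assms] obtain K where K: "\<forall>(m, G)\<in>#K. 0 < m \<and> m < d \<and> G \<in> HP m"
    "F \<in> alg_gen (of_degree d Y \<union> snd ` set_mset K)"
    "\<forall>v. (\<forall>G\<in>of_degree d Y. G v = 0) \<longrightarrow> (\<forall>(m, G)\<in>#K. G v = 0) \<longrightarrow> F v = 0" by blast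
  have "of_degree d Y \<union> snd ` set_mset K \<subseteq> snd ` set_mset (Y + K)"
    by (force simp: of_degree_def)
  then have "F \<in> alg_gen (snd ` set_mset (Y + K))" using K(2) alg_gen_mono by blast
  moreover have "zeros (Y + K) \<subseteq> zeros (add_mset (d, F) Y)"
  proof
    fix v assume v: "v \<in> zeros (Y + K)"
    then have "\<forall>G\<in>of_degree d Y. G v = 0" "\<forall>(m, G)\<in>#K. G v = 0" by (auto simp: zeros_def of_degree_def)
    then show "v \<in> zeros (add_mset (d, F) Y)" using K(3) v by auto
  qed
  ultimately show ?thesis using K(1) by (intro exI[of _ K]) (auto simp: valid_def)
qed

text \<open>\<open>K\<close> consists of the mixed Taylor coefficients in direction
  \<open>e\<close>. On their common zeros only the two extreme terms of each expansion
  survive.\<close>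

lemma mixed_terms:
  assumes "valid Y"
  shows "\<exists>K. valid K \<and> (\<forall>m G. (m, G) \<in># K \<longrightarrow> (\<exists>d F. (d, F) \<in># Y \<and> m < d)) \<and>
    (\<forall>d F v t. (d, F) \<in># Y \<longrightarrow> v \<in> zeros K \<longrightarrow> F (v + smul t e) = F v + t ^ d * F e)"
  using assms
proof (induction Y)
  case empty
  show ?case by (intro exI[of _ "{#}"]) auto
next
  case (add y Y)
  obtain d F where y: "y = (d, F)" by (cases y)
  have F: "F \<in> HP d" "0 < d" "valid Y" using add.prems y by auto
  obtain K where K: "valid K" "\<And>m G. (m, G) \<in># K \<Longrightarrow> \<exists>d F. (d, F) \<in># Y \<and> m < d"
    "\<And>d F v t. (d, F) \<in># Y \<Longrightarrow> v \<in> zeros K \<Longrightarrow> F (v + smul t e) = F v + t ^ d * F e"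
    using add.IH[OF F(3)] by blast
  obtain D where D: "\<And>j. j \<in> {1..<d} \<Longrightarrow> D j \<in> HP (d - j)"
    and eq: "\<And>v t. F (v + smul t e) = F v + (\<Sum>j\<in>{1..<d}. t ^ j * D j v) + t ^ d * F e"
    using HP_expand_middle[OF F(1,2)] by blast
  define L where "L = image_mset (\<lambda>j. (d - j, D j)) (mset_set {1..<d})"
  have L: "valid L" using D by (auto simp: L_def valid_def)
  have zL: "(\<Sum>j\<in>{1..<d}. t ^ j * D j v) = 0" if "v \<in> zeros L" for v t
    using that by (intro sum.neutral) (auto simp: L_def zeros_def)
  have "\<exists>d F. (d, F) \<in># add_mset y Y \<and> m < d" if "(m, G) \<in># K + L" for m G
    using that K(2)[of m G] y by (fastforce simp: L_def)
  moreover have "H (v + smul t e) = H v + t ^ c * H e"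
    if "(c, H) \<in># add_mset y Y" "v \<in> zeros (K + L)" for c H v t
    using that K(3) eq zL y by auto
  ultimately show ?case using K(1) L by (intro exI[of _ "K + L"]) auto
qed

lemma HP_attains:
  assumes "F \<in> HP d" "0 < d" "F e \<noteq> 0"
  shows "\<exists>t. F (smul t e) = c"
proof -
  obtain t where "t ^ d = c / F e" using nth_root_exists[OF assms(2)] by metis
  then show ?thesis using HP_homogeneous[OF assms(1), of t e] assms(3) by auto
qed

lemma zeros_smul: "valid Y \<Longrightarrow> v \<in> zeros Y \<Longrightarrow> smul t v \<in> zeros Y"
  by (fastforce simp: zeros_def valid_def HP_homogeneous)

text \<open>\<open>F\<close> is split off because it is the only coefficient in the expansion that
  need not come from degrees below n; the coefficient of t^n contributes the constant
  \<open>F e\<close>.\<close>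

lemma HP_expand_family:
  assumes "F \<in> HP n"
  shows "\<exists>P\<in>poly_family (low n). \<forall>v t. F (v + smul t e) = F v + poly (P v) t"
proof (cases "n = 0")
  case True
  then have "F (v + smul t e) = F v + poly [:0:] t" for v t using assms HP_0_iff by auto
  then show ?thesis by (intro bexI[OF _ poly_family_const[OF alg_gen.const[of 0]]]) auto
next
  case False
  then obtain D where D: "\<And>j. j \<in> {1..<n} \<Longrightarrow> D j \<in> HP (n - j)"
    and eq: "\<And>v t. F (v + smul t e) = F v + (\<Sum>j\<in>{1..<n}. t ^ j * D j v) + t ^ n * F e"
    using HP_expand_middle[OF assms] by blast
  define P where "P v = (\<Sum>j\<in>{1..<n}. [:0, 1:] ^ j * [:D j v:]) + [:0, 1:] ^ n * [:F e:]" for v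
  have "D j \<in> alg_gen (low n)" if "j \<in> {1..<n}" for j
    using D[OF that] that by (intro alg_gen.gen) (force simp: low_def)
  then have "P \<in> poly_family (low n)"
    unfolding P_def
    by (intro poly_family_add poly_family_sum poly_family_mult poly_family_power poly_family_var
        poly_family_const alg_gen.const) auto
  moreover have "F (v + smul t e) = F v + poly (P v) t" for v t
    unfolding eq P_def by (simp add: poly_sum poly_power mult.commute)
  ultimately show ?thesis by blast
qed

lemma alg_gen_low_expand_family:
  assumes "c \<in> alg_gen (low n)"
  shows "\<exists>P\<in>poly_family (low n). \<forall>v t. c (v + smul t e) = poly (P v) t"
  using assms
proof induction
  case (gen F)
  then obtain m where m: "m < n" "F \<in> HP m" by (auto simp: low_def)
  obtain P where P: "P \<in> poly_family (low m)" "\<And>v t. F (v + smul t e) = F v + poly (P v) t"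
    using HP_expand_family[OF m(2)] by blast
  have "P \<in> poly_family (low n)"
    using P(1) alg_gen_mono[OF low_mono, of m n] m(1) by (auto simp: poly_family_def)
  then have "(\<lambda>v. [:F v:] + P v) \<in> poly_family (low n)"
    using gen by (intro poly_family_add poly_family_const alg_gen.gen)
  then show ?case using P(2) by (intro bexI) auto
next
  case (const c)
  show ?case by (intro bexI[OF _ poly_family_const[OF alg_gen.const[of c]]]) auto
next
  case (add F G)
  then obtain P Q where "P \<in> poly_family (low n)" "Q \<in> poly_family (low n)"
    "\<forall>v t. F (v + smul t e) = poly (P v) t" "\<forall>v t. G (v + smul t e) = poly (Q v) t" by blast
  then show ?case by (intro bexI[OF _ poly_family_add[of P _ Q]]) auto
next
  case (mult F G)
  then obtain P Q where "P \<in> poly_family (low n)" "Q \<in> poly_family (low n)"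
    "\<forall>v t. F (v + smul t e) = poly (P v) t" "\<forall>v t. G (v + smul t e) = poly (Q v) t" by blast
  then show ?case by (intro bexI[OF _ poly_family_mult[of P _ Q]]) auto
qed

section \<open>Extraction of p-th roots\<close>

lemma alg_gen_low_char_powers:
  assumes prime: "prime CHAR('k)"
  shows "alg_gen {(\<lambda>v. c v ^ CHAR('k)) | c. c \<in> alg_gen (low n)} = {(\<lambda>v. c v ^ CHAR('k)) | c. c \<in> alg_gen (low n)}"
    (is "alg_gen ?A = ?A")
proof
  show "alg_gen ?A \<subseteq> ?A"
  proof
    fix F assume "F \<in> alg_gen ?A"
    then show "F \<in> ?A"
    proof induction
      case (const c)
      \<comment> \<open>Constants are themselves p-th powers, as \<open>'k\<close> is algebraically
        closed.\<close>
      obtain r where "r ^ CHAR('k) = c" using nth_root_exists[of "CHAR('k)"] prime_gt_0_nat[OF prime] by metis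
      then show ?case using alg_gen.const[of r "low n"] by (intro CollectI exI[of _ "\<lambda>_. r"]) auto
    next
      case (add F G)
      then obtain a b where "F = (\<lambda>v. a v ^ CHAR('k))" "G = (\<lambda>v. b v ^ CHAR('k))"
        "a \<in> alg_gen (low n)" "b \<in> alg_gen (low n)" by blast
      then show ?case using alg_gen.add[of a "low n" b] freshmans_dream[OF prime refl]
        by (intro CollectI exI[of _ "\<lambda>v. a v + b v"]) auto
    next
      case (mult F G)
      then obtain a b where "F = (\<lambda>v. a v ^ CHAR('k))" "G = (\<lambda>v. b v ^ CHAR('k))"
        "a \<in> alg_gen (low n)" "b \<in> alg_gen (low n)" by blast
      then show ?case using alg_gen.mult[of a "low n" b]
        by (intro CollectI exI[of _ "\<lambda>v. a v * b v"]) (auto simp: power_mult_distrib)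
    qed
  qed
qed (auto intro: alg_gen.gen)

lemma alg_gen_low_subset_Pol: "alg_gen (low n) \<subseteq> Pol"
proof -
  have "low n \<subseteq> low (Suc n)" by (rule low_mono) simp
  then have "alg_gen (low n) \<subseteq> Pol_dec (Suc n) {}"
    using low_subset_Pol_dec by (intro alg_gen_subset_Pol_dec) blast+
  then show ?thesis using Pol_dec_subset_Pol[of "{}" "Suc n"] by blast
qed

text \<open>Write w = z^p as a polynomial in finitely many functions of degree below n and eliminate
  these, largest degree first. A function of finite strength modulo the others of its degree is
  replaced by its factors; any other drops out by \<open>frobenius_independence\<close>. Finally w
  is a polynomial in p-th powers, hence equal to c^p with \<open>c\<close> in
  \<open>alg_gen (low n)\<close>, and p-th roots are unique.\<close>

lemma char_root_in_alg_gen_low: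
  assumes prime: "prime CHAR('k)" and z: "z \<in> Pol" and zp: "(\<lambda>v. z v ^ CHAR('k)) \<in> alg_gen (low n)"
  shows "z \<in> alg_gen (low n)"
proof -
  define C where "C = {(\<lambda>v. c v ^ CHAR('k)) | c. c \<in> alg_gen (low n)}"
  define w where "w v = z v ^ CHAR('k)" for v
  have p: "CHAR('k) > 0" using prime_gt_0_nat[OF prime] .
  have C_frob: "C \<subseteq> frob" using alg_gen_low_subset_Pol by (auto simp: C_def frob_def)
  have w_frob: "w \<in> frob" using z unfolding frob_def by (intro CollectI exI[of _ z]) (auto simp: w_def)
  have main: "(\<forall>(m, G)\<in>#Y. m < n) \<longrightarrow> w \<in> alg_gen (C \<union> snd ` set_mset Y) \<longrightarrow> w \<in> alg_gen C"
    if "valid Y" for Y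
    using that
  proof (induction Y rule: system_induct)
    case empty
    then show ?case by simp
  next
    case (step d F Y)
    show ?case
    proof (intro impI)
      assume lt: "\<forall>(m, G)\<in>#add_mset (d, F) Y. m < n"
        and w: "w \<in> alg_gen (C \<union> snd ` set_mset (add_mset (d, F) Y))"
      show "w \<in> alg_gen C"
      proof (cases "F \<in> dec d (of_degree d Y)")
        case True
        obtain K where K: "valid K" "\<And>m G. (m, G) \<in># K \<Longrightarrow> m < d"
          "F \<in> alg_gen (snd ` set_mset (Y + K))" "zeros (Y + K) \<subseteq> zeros (add_mset (d, F) Y)"
          using dec_eliminate[OF True] by blast
        let ?B = "C \<union> snd ` set_mset (Y + K)"
        have "F \<in> alg_gen ?B" using K(3) alg_gen_mono[of "snd ` set_mset (Y + K)" ?B] by blast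
        then have "C \<union> snd ` set_mset (add_mset (d, F) Y) \<subseteq> alg_gen ?B" by (auto intro: alg_gen.gen)
        then have "w \<in> alg_gen ?B" using w alg_gen_closed by blast
        moreover have "\<forall>(m, G)\<in>#Y + K. m < n"
          using lt K(2) by (auto dest: less_trans)
        moreover have "(\<forall>(m, G)\<in>#Y + K. m < n) \<longrightarrow> w \<in> alg_gen ?B \<longrightarrow> w \<in> alg_gen C"
          by (rule step.IH) (use K in auto)
        ultimately show ?thesis by simp
      next
        case False
        let ?A = "C \<union> snd ` set_mset Y"
        have "F \<in> alg_gen (low n)" using step.hyps(3) lt by (intro alg_gen.gen) (auto simp: low_def)
        then have Fp: "(\<lambda>v. F v ^ CHAR('k)) \<in> alg_gen ?A" by (intro alg_gen.gen) (auto simp: C_def)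
        have "w \<in> alg_gen (insert F ?A)" using w by simp
        from alg_gen_insert_power[OF this p Fp] obtain c where c: "\<And>i. c i \<in> alg_gen ?A"
          and w_eq: "\<And>v. w v = (\<Sum>i<CHAR('k). c i v * F v ^ i)" by blast
        define R where "R = alg_gen (frob \<union> low d \<union> of_degree d Y)"
        have "snd ` set_mset Y \<subseteq> low d \<union> of_degree d Y"
          using step.hyps(1,4) by (fastforce simp: valid_def low_def of_degree_def order.order_iff_strict)
        then have A_R: "alg_gen ?A \<subseteq> R" unfolding R_def using C_frob by (intro alg_gen_mono) blast
        \<comment> \<open>The p-th power \<open>w\<close> belongs to the coefficient algebra
          \<open>R\<close>, so it may be moved into the coefficient of F^0. Independence then forces
          \<open>w\<close> to equal \<open>c 0\<close>, which does not involve
          \<open>F\<close>.\<close>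
        define m where "m i v = (if i = 0 then c 0 v - w v else c i v)" for i v
        have m_R: "m i \<in> R" for i
        proof (cases "i = 0")
          case True
          have "w \<in> R" "c 0 \<in> R" using w_frob c[of 0] A_R by (auto simp: R_def intro: alg_gen.gen)
          then have "(\<lambda>v. c 0 v - w v) \<in> R" unfolding R_def by (intro alg_gen_diff)
          moreover have "m i = (\<lambda>v. c 0 v - w v)" using True by (auto simp: m_def)
          ultimately show ?thesis by simp
        next
          case False
          then have "m i = c i" by (auto simp: m_def)
          then show ?thesis using c[of i] A_R by auto
        qed
        obtain N where N: "CHAR('k) = Suc N" using p by (cases "CHAR('k)") auto
        have "(\<Sum>i\<le>N. m i v * F v ^ i) = 0" for v
        proof -
          have "w v = (\<Sum>i\<le>N. c i v * F v ^ i)" using w_eq N by (simp add: lessThan_Suc_atMost)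
          moreover have "(\<Sum>i\<le>N. m i v * F v ^ i) = (\<Sum>i\<le>N. c i v * F v ^ i) - (\<Sum>i\<le>N. if i = 0 then w v else 0)"
            unfolding sum_subtractf[symmetric] by (intro sum.cong) (auto simp: m_def)
          ultimately show ?thesis by simp
        qed
        then have "m 0 = (\<lambda>_. 0)"
          using frobenius_independence[OF prime step.hyps(2) of_degree_subset_HP[OF step.hyps(1)]
              step.hyps(3) False R_def, of N m 0] m_R N by simp
        then have "w = c 0" by (auto simp: m_def fun_eq_iff)
        then have "w \<in> alg_gen ?A" using c[of 0] by simp
        then show ?thesis using step.IH[of "{#}"] lt by auto
      qed
    qed
  qed
  obtain B where B: "finite B" "B \<subseteq> low n" "w \<in> alg_gen B"
    using alg_gen_finite_subset[OF zp] unfolding w_def by blast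
  have "\<forall>F\<in>B. \<exists>m. m < n \<and> F \<in> HP m" using B(2) by (auto simp: low_def)
  then obtain deg where deg: "\<And>F. F \<in> B \<Longrightarrow> deg F < n \<and> F \<in> HP (deg F)" by metis
  \<comment> \<open>Generators of degree 0 are constants and are left out, since equations must have
    positive degree.\<close>
  define Y where "Y = image_mset (\<lambda>F. (deg F, F)) (mset_set {F\<in>B. deg F > 0})"
  have "valid Y" using B(1) deg by (auto simp: Y_def valid_def)
  moreover have "\<forall>(m, G)\<in>#Y. m < n" using B(1) deg by (auto simp: Y_def)
  moreover have "B \<subseteq> alg_gen (C \<union> snd ` set_mset Y)"
  proof
    fix F assume F: "F \<in> B"
    show "F \<in> alg_gen (C \<union> snd ` set_mset Y)"
    proof (cases "deg F > 0")
      case True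
      then show ?thesis using F B(1) by (intro alg_gen.gen) (auto simp: Y_def image_image)
    next
      case False
      then obtain c where "F = (\<lambda>_. c)" using deg[OF F] HP_0_iff by auto
      then show ?thesis by (auto intro: alg_gen.const)
    qed
  qed
  then have "w \<in> alg_gen (C \<union> snd ` set_mset Y)" using B(3) alg_gen_closed by blast
  ultimately have "w \<in> alg_gen C" using main by blast
  then have "w \<in> C" using alg_gen_low_char_powers[OF prime] unfolding C_def by blast
  then obtain c where c: "c \<in> alg_gen (low n)" "w = (\<lambda>v. c v ^ CHAR('k))" by (auto simp: C_def)
  have "z v = c v" for v
  proof -
    have "(c v + (z v - c v)) ^ CHAR('k) = c v ^ CHAR('k) + (z v - c v) ^ CHAR('k)"
      by (rule freshmans_dream[OF prime refl])
    moreover have "z v ^ CHAR('k) = c v ^ CHAR('k)" using c(2) by (metis w_def)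
    ultimately show ?thesis by simp
  qed
  then have "z = c" by auto
  then show ?thesis using c(1) by simp
qed

text \<open>A monomial of degree n in functions of smaller degree has at least two factors of
  positive degree, so the component of degree n has finite strength.\<close>

lemma alg_gen_low_dec:
  assumes "x \<in> alg_gen (low n)" "x \<in> HP n" "n > 0"
  shows "x \<in> dec n S"
proof -
  have "x \<in> Pol_dec n {}"
    using alg_gen_subset_Pol_dec[OF assms(3) _ low_subset_Pol_dec, of "{}"] assms(1) by auto
  then have "x \<in> dec n {}" using assms(2) by (intro Pol_dec_homogeneous) auto
  then show ?thesis using dec_mono[of "{}" S] by auto
qed

lemma char_power_root_in_alg_gen_low:
  assumes "q \<in> char_powers TYPE('k)" "x \<in> HP n" "(\<lambda>v. x v ^ q) \<in> alg_gen (low n)"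
  shows "x \<in> alg_gen (low n)"
  using assms(1,3)
proof (induction rule: char_powers.induct)
  case (step q)
  have "(\<lambda>v. x v ^ q) \<in> Pol" using HP_power[OF assms(2)] by (rule Pol_HP)
  moreover have "(\<lambda>v. (x v ^ q) ^ CHAR('k)) \<in> alg_gen (low n)"
    using step.prems by (simp add: power_mult[symmetric] mult.commute)
  ultimately show ?case using char_root_in_alg_gen_low[OF step.hyps(1)] step.IH by blast
qed simp

section \<open>The Nullstellensatz\<close>

text \<open>The second statement is the one that survives the elimination of an equation of degree less
  than \<open>n\<close>; its induction step needs the first one for the existence of \<open>e\<close>.\<close>

lemma vanishing:
  assumes "valid Y"
  shows "(\<forall>n x. 0 < n \<longrightarrow> (\<forall>(m, G)\<in>#Y. m \<le> n) \<longrightarrow> x \<in> HP n \<longrightarrow> (\<forall>v\<in>zeros Y. x v = 0)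
      \<longrightarrow> x \<in> dec n (of_degree n Y)) \<and>
    (\<forall>n x q c. (\<forall>(m, G)\<in>#Y. m < n) \<longrightarrow> x \<in> HP n \<longrightarrow> q \<in> char_powers TYPE('k) \<longrightarrow> c \<in> alg_gen (low n)
      \<longrightarrow> (\<forall>v\<in>zeros Y. x v ^ q = c v) \<longrightarrow> x \<in> alg_gen (low n))"
  (is "?vanish Y \<and> ?root Y")
  using assms
proof (induction Y rule: system_induct)
  case empty
  have "x \<in> alg_gen (low n)" if "x \<in> HP n" "q \<in> char_powers TYPE('k)" "c \<in> alg_gen (low n)" "\<forall>v. x v ^ q = c v"
    for n x q c
  proof -
    have "(\<lambda>v. x v ^ q) = c" using that(4) by auto
    then show ?thesis using char_power_root_in_alg_gen_low that by auto
  qed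
  moreover have "x \<in> dec n S" if "\<forall>v. x v = 0" for x n S
  proof -
    have "x = (\<lambda>_. 0)" using that by auto
    then show ?thesis using dec.zero by simp
  qed
  ultimately show ?case by auto
next
  case (step d F Y)
  note IH = step.IH
  have max: "m \<le> d" if "(m, G) \<in># Y" for m G using step.hyps that by blast
  have IHv: "x \<in> dec n (of_degree n (Y + K))"
    if "valid K" "\<And>m G. (m, G) \<in># K \<Longrightarrow> m < d" "d \<le> n" "x \<in> HP n" "\<forall>v\<in>zeros (Y + K). x v = 0" for n x K
  proof -
    have "\<forall>(m, G)\<in>#Y + K. m \<le> n" "0 < n" using max that(2,3) step.hyps(2) by fastforce+
    then show ?thesis
      using conjunct1[OF IH[OF that(1,2)], THEN spec[where x = n], THEN spec[where x = x]] that(4,5) by simp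
  qed
  have IHr: "x \<in> alg_gen (low n)"
    if "valid K" "\<And>m G. (m, G) \<in># K \<Longrightarrow> m < d" "d < n" "x \<in> HP n" "q \<in> char_powers TYPE('k)"
      "c \<in> alg_gen (low n)" "\<forall>v\<in>zeros (Y + K). x v ^ q = c v" for n x q c K
  proof -
    have "\<forall>(m, G)\<in>#Y + K. m < n" using max that(2,3) by fastforce
    then show ?thesis
      using conjunct2[OF IH[OF that(1,2)], THEN spec[where x = n], THEN spec[where x = x],
        THEN spec[where x = q], THEN spec[where x = c]] that(4-7)
      by simp
  qed
  \<comment> \<open>Equations of degree below \<open>d\<close> are invisible in degrees n at least
    \<open>d\<close>, so adding them does not weaken the conclusion.\<close>
  have of_degree_low: "of_degree n (Y + K) \<subseteq> of_degree n (add_mset (d, F) Y)"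
    if "\<And>m G. (m, G) \<in># K \<Longrightarrow> m < d" "d \<le> n" for K n
    using that by (fastforce simp: of_degree_def)
  show ?case
  proof (cases "F \<in> dec d (of_degree d Y)")
    case True
    obtain K where K: "valid K" "\<And>m G. (m, G) \<in># K \<Longrightarrow> m < d"
      "F \<in> alg_gen (snd ` set_mset (Y + K))" "zeros (Y + K) \<subseteq> zeros (add_mset (d, F) Y)"
      using dec_eliminate[OF True] by blast
    have "?vanish (add_mset (d, F) Y)"
    proof (intro allI impI)
      fix n x assume a: "0 < n" "\<forall>(m, G)\<in>#add_mset (d, F) Y. m \<le> n" "x \<in> HP n"
        "\<forall>v\<in>zeros (add_mset (d, F) Y). x v = 0"
      have "x \<in> dec n (of_degree n (Y + K))" using a K by (intro IHv) auto
      then show "x \<in> dec n (of_degree n (add_mset (d, F) Y))"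
        using dec_mono[OF of_degree_low[of K n], of n] K(2) a(2) by auto
    qed
    moreover have "?root (add_mset (d, F) Y)"
    proof (intro allI impI)
      fix n x q c assume a: "\<forall>(m, G)\<in>#add_mset (d, F) Y. m < n" "x \<in> HP n" "q \<in> char_powers TYPE('k)"
        "c \<in> alg_gen (low n)" "\<forall>v\<in>zeros (add_mset (d, F) Y). x v ^ q = c v"
      show "x \<in> alg_gen (low n)" using a K by (intro IHr[of K n x q c]) auto
    qed
    ultimately show ?thesis by blast
  next
    case False
    \<comment> \<open>If \<open>F\<close> vanished on all zeros of \<open>Y\<close>, the first
      statement for \<open>Y\<close> alone would put it into \<open>dec d (of_degree d Y)\<close>.
      Scaling normalises the value to 1.\<close>
    obtain e where e: "F e = 1" "e \<in> zeros Y"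
    proof -
      have "\<exists>v\<in>zeros Y. F v \<noteq> 0"
        using IHv[of "{#}" d F] False step.hyps(3) by auto
      then obtain v where v: "v \<in> zeros Y" "F v \<noteq> 0" by blast
      then obtain t where "F (smul t v) = 1" using HP_attains[OF step.hyps(3,2)] by blast
      then show thesis using that zeros_smul[OF step.hyps(1) v(1)] by blast
    qed
    have valid': "valid (add_mset (d, F) Y)" using step.hyps by simp
    obtain K where K: "valid K" "\<And>m G. (m, G) \<in># K \<Longrightarrow> m < d"
      and K_eq: "\<And>c H v t. (c, H) \<in># add_mset (d, F) Y \<Longrightarrow> v \<in> zeros K \<Longrightarrow> H (v + smul t e) = H v + t ^ c * H e"
    proof -
      obtain K where K: "valid K" "\<And>m G. (m, G) \<in># K \<Longrightarrow> \<exists>c H. (c, H) \<in># add_mset (d, F) Y \<and> m < c"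
        "\<And>c H v t. (c, H) \<in># add_mset (d, F) Y \<Longrightarrow> v \<in> zeros K \<Longrightarrow> H (v + smul t e) = H v + t ^ c * H e"
        using mixed_terms[OF valid', of e] by blast
      have "m < d" if mem: "(m, G) \<in># K" for m G
      proof -
        obtain c H where "(c, H) \<in># add_mset (d, F) Y" "m < c" using K(2)[OF mem] by blast
        then show ?thesis using max[of c H] by auto
      qed
      then show thesis using K(1,3) by (intro that[of K])
    qed
    \<comment> \<open>The choice of t cancels \<open>F v\<close> against t^d; the other equations
      hold at both v and e, and without mixed terms also at v + te.\<close>
    have move: "v + smul t e \<in> zeros (add_mset (d, F) Y)"
      if v: "v \<in> zeros (Y + K)" and t: "t ^ d = - F v" for v t
    proof -
      have "F (v + smul t e) = 0" using K_eq[of d F v t] v t e(1) by simp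
      moreover have "H (v + smul t e) = 0" if "(c, H) \<in># Y" for c H
      proof -
        have "H v = 0" "H e = 0" using v e(2) that by (auto simp: zeros_def)
        then show ?thesis using K_eq[of c H v t] that v by simp
      qed
      ultimately show ?thesis by (auto simp: zeros_def)
    qed
    have root: "?root (add_mset (d, F) Y)"
    proof (intro allI impI)
      fix n x q c assume a: "\<forall>(m, G)\<in>#add_mset (d, F) Y. m < n" "x \<in> HP n" "q \<in> char_powers TYPE('k)"
        "c \<in> alg_gen (low n)" "\<forall>v\<in>zeros (add_mset (d, F) Y). x v ^ q = c v"
      have dn: "d < n" using a(1) by auto
      obtain P where P: "P \<in> poly_family (low n)" "\<And>v t. x (v + smul t e) = x v + poly (P v) t"
        using HP_expand_family[OF a(2)] by blast
      obtain Q where Q: "Q \<in> poly_family (low n)" "\<And>v t. c (v + smul t e) = poly (Q v) t"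
        using alg_gen_low_expand_family[OF a(4)] by blast
      \<comment> \<open>As the q-th power is additive, x(v + te)^q = c(v + te) becomes x(v)^q =
        R_v(t). So R_v takes the value x(v)^q at all roots of t^d = -F(v).\<close>
      define R where "R v = Q v - P v ^ q" for v
      have R: "R \<in> poly_family (low n)"
        unfolding R_def using P(1) Q(1) by (intro poly_family_diff poly_family_power)
      obtain J where J: "\<And>v. degree (R v) \<le> J" using poly_family_degree[OF R] by blast
      obtain q' m where q': "q' \<in> char_powers TYPE('k)" and
        roots: "\<forall>(P :: 'k poly) s X J. degree P \<le> J \<longrightarrow> (\<forall>t. t ^ d = s \<longrightarrow> poly P t = X) \<longrightarrow>
          X ^ q' = (\<Sum>j\<le>J. if m dvd j then coeff P j ^ q' * s ^ (j div m) else 0)"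
        using constant_on_roots[OF step.hyps(2), where 'k = 'k] by blast
      \<comment> \<open>The formula of \<open>constant_on_roots\<close> with s = -F(v). It only
        involves functions of degree below n, as \<open>F\<close> has degree d < n.\<close>
      define c' where "c' v = (\<Sum>j\<le>J. if m dvd j then coeff (R v) j ^ q' * (- F v) ^ (j div m) else 0)" for v
      have "F \<in> alg_gen (low n)" using step.hyps(3) dn by (intro alg_gen.gen) (auto simp: low_def)
      then have summand: "(\<lambda>v. if m dvd j then coeff (R v) j ^ q' * (- F v) ^ (j div m) else 0) \<in> alg_gen (low n)" for j
        by (cases "m dvd j")
          (auto intro!: alg_gen.mult alg_gen_power alg_gen_uminus poly_family_coeff[OF R] alg_gen.const)
      have c': "c' \<in> alg_gen (low n)" unfolding c'_def by (intro alg_gen_sum summand)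
      have "x v ^ (q * q') = c' v" if v: "v \<in> zeros (Y + K)" for v
      proof -
        have "poly (R v) t = x v ^ q" if t: "t ^ d = - F v" for t
        proof -
          have "x (v + smul t e) ^ q = c (v + smul t e)" using move[OF v t] a(5) by blast
          then show ?thesis
            by (simp add: P(2) Q(2) char_powers_add[OF a(3)] R_def poly_power eq_diff_eq[symmetric])
        qed
        then have "(x v ^ q) ^ q' = c' v" using roots J unfolding c'_def by blast
        then show ?thesis by (simp add: power_mult)
      qed
      then show "x \<in> alg_gen (low n)"
        using char_powers_mult[OF a(3) q'] c' K dn a(2) by (intro IHr[of K n x "q * q'" c']) auto
    qed
    moreover have "?vanish (add_mset (d, F) Y)"
    proof (intro allI impI)
      fix n x assume a: "0 < n" "\<forall>(m, G)\<in>#add_mset (d, F) Y. m \<le> n" "x \<in> HP n"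
        "\<forall>v\<in>zeros (add_mset (d, F) Y). x v = 0"
      have dn: "d \<le> n" using a(2) by auto
      show "x \<in> dec n (of_degree n (add_mset (d, F) Y))"
      proof (cases "d = n")
        case False
        then have "\<forall>(m, G)\<in>#add_mset (d, F) Y. m < n" using dn max by fastforce
        \<comment> \<open>The second statement with q = 1 and c = 0.\<close>
        then have "x \<in> alg_gen (low n)"
          using root a(3,4) char_powers.one alg_gen.const[of 0]
          by (elim allE[of _ n] allE[of _ x] allE[of _ 1] allE[of _ "\<lambda>_. 0"]) auto
        then show ?thesis using a(1,3) by (intro alg_gen_low_dec)
      next
        case True
        obtain L where L: "valid L" "\<And>m G. (m, G) \<in># L \<Longrightarrow> m < d"
          and L_eq: "\<And>v t. v \<in> zeros L \<Longrightarrow> x (v + smul t e) = x v + t ^ n * x e"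
        proof -
          have "valid {#(n, x)#}" using a(1,3) by simp
          then obtain L where "valid L" "\<And>m G. (m, G) \<in># L \<Longrightarrow> \<exists>c H. (c, H) \<in># {#(n, x)#} \<and> m < c"
            "\<And>c H v t. (c, H) \<in># {#(n, x)#} \<Longrightarrow> v \<in> zeros L \<Longrightarrow> H (v + smul t e) = H v + t ^ c * H e"
            using mixed_terms[of "{#(n, x)#}" e] by blast
          then show thesis using True by (intro that[of L]) auto
        qed
        \<comment> \<open>Now the mixed terms of \<open>x\<close> are required to vanish as well.
          For t^n = -F(v) this gives 0 = x(v + te) = x(v) - x(e) F(v), so \<open>x'\<close> vanishes
          on the zeros of the smaller system.\<close>
        define x' where "x' v = x v - x e * F v" for v
        have F: "F \<in> HP n" using step.hyps(3) True by simp
        have "x' \<in> HP n" unfolding x'_def using a(3) F by (intro HP_diff HP_scale)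
        moreover have "x' v = 0" if v: "v \<in> zeros (Y + (K + L))" for v
        proof -
          obtain t where t: "t ^ d = - F v" using nth_root_exists[OF step.hyps(2)] by metis
          have "x (v + smul t e) = 0" using move[OF _ t] v a(4) by auto
          then show ?thesis using L_eq[of v t] v t True by (simp add: x'_def mult.commute)
        qed
        ultimately have "x' \<in> dec n (of_degree n (Y + (K + L)))"
          using K L dn by (intro IHv) auto
        moreover have "of_degree n (Y + (K + L)) \<subseteq> of_degree n (add_mset (d, F) Y)"
          using K(2) L(2) dn by (intro of_degree_low) auto
        ultimately have "x' \<in> dec n (of_degree n (add_mset (d, F) Y))" using dec_mono by blast
        moreover have "F \<in> dec n (of_degree n (add_mset (d, F) Y))"
          using True by (auto simp: of_degree_def intro: dec.base)
        ultimately have "(\<lambda>v. x' v + x e * F v) \<in> dec n (of_degree n (add_mset (d, F) Y))"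
          by (intro dec.add dec.scale)
        then show ?thesis by (simp add: x'_def)
      qed
    qed
    ultimately show ?thesis by blast
  qed
qed

section \<open>Solving the equations one at a time\<close>

lemma surjective:
  fixes f :: "'a \<Rightarrow> 'v \<Rightarrow> 'k"
  assumes "finite J" and "\<And>j. j \<in> J \<Longrightarrow> 0 < d j \<and> f j \<in> HP (d j)"
    and "\<And>i. i \<in> J \<Longrightarrow> f i \<notin> dec (d i) {f j | j. j \<in> J - {i} \<and> d j = d i}"
  shows "\<exists>v. \<forall>j\<in>J. f j v = c j"
  using assms
proof (induction J rule: finite_psubset_induct)
  case (psubset J)
  show ?case
  proof (cases "J = {}")
    case False
    then have "Max (d ` J) \<in> d ` J" using psubset.hyps by (intro Max_in) auto
    then obtain i where i: "i \<in> J" "d i = Max (d ` J)" by auto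
    then have max: "d j \<le> d i" if "j \<in> J" for j using psubset.hyps that by simp
    have "\<exists>u. \<forall>j\<in>J - {i}. f j u = c j"
    proof (rule psubset.IH)
      show "f k \<notin> dec (d k) {f j | j. j \<in> J - {i} - {k} \<and> d j = d k}" if "k \<in> J - {i}" for k
        using psubset.prems(2)[of k] that
          dec_mono[of "{f j | j. j \<in> J - {i} - {k} \<and> d j = d k}" "{f j | j. j \<in> J - {k} \<and> d j = d k}"]
        by blast
    qed (use i psubset.prems in auto)
    then obtain u where u: "\<And>j. j \<in> J - {i} \<Longrightarrow> f j u = c j" by blast
    define X where "X I = image_mset (\<lambda>j. (d j, f j)) (mset_set I)" for I
    have "valid (X J)" using psubset.prems(1) psubset.hyps by (auto simp: X_def valid_def)
    then obtain K where K: "valid K" "\<And>m G. (m, G) \<in># K \<Longrightarrow> \<exists>c H. (c, H) \<in># X J \<and> m < c"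
      and K_eq: "\<And>c H v t. (c, H) \<in># X J \<Longrightarrow> v \<in> zeros K \<Longrightarrow> H (v + smul t u) = H v + t ^ c * H u"
      using mixed_terms[of "X J" u] by blast
    \<comment> \<open>The other functions together with all mixed terms in direction
      \<open>u\<close>. The mixed terms have degree below the maximal degree \<open>d i\<close>, so
      they do not affect \<open>of_degree (d i) Y\<close>, and the Nullstellensatz yields a zero of
      \<open>Y\<close> at which \<open>f i\<close> is nonzero.\<close>
    define Y where "Y = X (J - {i}) + K"
    have Y: "valid Y" using K(1) psubset.prems(1) psubset.hyps by (auto simp: Y_def X_def valid_def)
    have K_lt: "m < d i" if "(m, G) \<in># K" for m G
      using K(2)[OF that] max psubset.hyps by (auto simp: X_def intro: less_le_trans)
    then have "\<forall>(m, G)\<in>#Y. m \<le> d i" using max psubset.hyps by (auto simp: Y_def X_def less_imp_le)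
    moreover have "of_degree (d i) Y \<subseteq> {f j | j. j \<in> J - {i} \<and> d j = d i}"
      using K_lt psubset.hyps by (auto simp: of_degree_def Y_def X_def)
    then have "f i \<notin> dec (d i) (of_degree (d i) Y)"
      using psubset.prems(2)[OF i(1)] dec_mono by blast
    ultimately have "\<not> (\<forall>v\<in>zeros Y. f i v = 0)"
      using conjunct1[OF vanishing[OF Y], THEN spec[where x = "d i"], THEN spec[where x = "f i"]]
        psubset.prems(1)[OF i(1)] by auto
    then obtain w where w: "w \<in> zeros Y" "f i w \<noteq> 0" by blast
    obtain t where t: "f i (smul t w) = c i - f i u"
      using HP_attains[of "f i" "d i" w] psubset.prems(1)[OF i(1)] w(2) by blast
    let ?w = "smul t w"
    have w': "?w \<in> zeros Y" using zeros_smul[OF Y w(1)] .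
    \<comment> \<open>Without mixed terms, the values at \<open>?w\<close> and at \<open>u\<close>
      simply add up.\<close>
    have "f j (?w + smul 1 u) = f j ?w + f j u" if "j \<in> J" for j
      using K_eq[of "d j" "f j" ?w 1] w' that psubset.hyps by (simp add: X_def Y_def)
    moreover have "f j ?w = 0" if "j \<in> J - {i}" for j
      using w' that psubset.hyps by (auto simp: Y_def X_def zeros_def)
    ultimately have "\<forall>j\<in>J. f j (?w + smul 1 u) = c j" using t u by force
    then show ?thesis by blast
  qed simp
qed

end

section \<open>Formal polynomials as functions\<close>

text \<open>Monomials involving a coordinate outside the support evaluate to 0, so one finite set of
  variables can serve several vectors.\<close>

lemma eval_hom_superset:
  fixes v :: "'i \<Rightarrow> 'k::comm_ring_1"
  assumes "finite S" "{i. v i \<noteq> 0} \<subseteq> S"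
  shows "eval_hom n f v = (\<Sum>m\<in>multisets_of_size S n. f m * (\<Prod>i\<in>#m. v i))"
proof -
  have "(\<Prod>i\<in>#m. v i) = 0" if "\<not> set_mset m \<subseteq> {i. v i \<noteq> 0}" for m
  proof -
    obtain i where "i \<in># m" "v i = 0" using \<open>\<not> set_mset m \<subseteq> {i. v i \<noteq> 0}\<close> by auto
    then obtain m' where "m = add_mset i m'" by (metis insert_DiffM)
    then show ?thesis using \<open>v i = 0\<close> by simp
  qed
  moreover have "finite (multisets_of_size S n)" using assms(1) by (simp add: finite_multisets_of_size)
  ultimately show ?thesis
    unfolding eval_hom_def image_prod_mset_multiplicity[symmetric] using assms(2)
    by (intro sum.mono_neutral_left) (auto simp: multisets_of_size_def)
qed

lemma eval_hom_add: "eval_hom n (\<lambda>m. f m + g m) v = eval_hom n f v + eval_hom n g v"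
  by (simp add: eval_hom_def ring_distribs sum.distrib)

lemma eval_hom_scale: "eval_hom n (\<lambda>m. c * f m) v = c * eval_hom n f v"
  by (simp add: eval_hom_def sum_distrib_left mult.assoc)

lemma eval_hom_0: "eval_hom 0 f v = f {#}"
proof -
  have "{m. size m = 0 \<and> set_mset m \<subseteq> {i. v i \<noteq> 0}} = {{#}}" by auto
  then show ?thesis by (simp add: eval_hom_def)
qed

lemma hom_of_deg_pmult:
  assumes "hom_of_deg a f" "hom_of_deg b g"
  shows "hom_of_deg (a + b) (pmult f g)"
  unfolding hom_of_deg_def
proof (intro allI impI)
  fix m :: "'a multiset" assume m: "size m \<noteq> a + b"
  have "f x * g (m - x) = 0" if "x \<subseteq># m" for x
  proof -
    have "size m = size x + size (m - x)"
      using that by (metis size_union subset_mset.add_diff_inverse)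
    then have "size x \<noteq> a \<or> size (m - x) \<noteq> b" using m by auto
    then show ?thesis using assms by (auto simp: hom_of_deg_def)
  qed
  then show "pmult f g m = 0" unfolding pmult_def by (intro sum.neutral) auto
qed

lemma finite_submultisets: "finite {x. x \<subseteq># m}"
proof (rule finite_subset)
  show "{x. x \<subseteq># m} \<subseteq> (\<Union>k\<le>size m. multisets_of_size (set_mset m) k)"
    by (auto simp: multisets_of_size_def size_mset_mono dest: mset_subset_eqD)
qed auto

lemma eval_hom_pmult:
  fixes v :: "'i \<Rightarrow> 'k::comm_ring_1"
  assumes v: "is_vec v" and f: "hom_of_deg a f" and g: "hom_of_deg b g"
  shows "eval_hom (a + b) (pmult f g) v = eval_hom a f v * eval_hom b g v"
proof -
  define S where "S = {i. v i \<noteq> 0}"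
  have S: "finite S" "{i. v i \<noteq> 0} \<subseteq> S" using v by (auto simp: S_def is_vec_def)
  note fin = finite_multisets_of_size[OF S(1)]
  let ?M = "multisets_of_size S"
  have fin': "finite {x. x \<subseteq># m}" for m :: "'i multiset" by (rule finite_submultisets)
  have "eval_hom (a + b) (pmult f g) v
      = (\<Sum>m\<in>?M (a + b). \<Sum>x\<in>{x. x \<subseteq># m}. f x * g (m - x) * (\<Prod>i\<in>#m. v i))"
    unfolding eval_hom_superset[OF S] pmult_def sum_distrib_right ..
  also have "\<dots> = (\<Sum>(m, x)\<in>Sigma (?M (a + b)) (\<lambda>m. {x. x \<subseteq># m}). f x * g (m - x) * (\<Prod>i\<in>#m. v i))"
    using fin fin' by (intro sum.Sigma) auto
  also have "\<dots> = (\<Sum>(m, x)\<in>Sigma (?M (a + b)) (\<lambda>m. {x. x \<subseteq># m \<and> size x = a}). f x * g (m - x) * (\<Prod>i\<in>#m. v i))"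
  proof (intro sum.mono_neutral_right)
    show "finite (Sigma (?M (a + b)) (\<lambda>m. {x. x \<subseteq># m}))" using fin fin' by auto
  qed (use f in \<open>auto simp: hom_of_deg_def\<close>)
  \<comment> \<open>A monomial with a chosen divisor of degree a is the same as a pair of monomials:
    the divisor and its cofactor.\<close>
  also have "\<dots> = (\<Sum>(x, y)\<in>?M a \<times> ?M b. (f x * (\<Prod>i\<in>#x. v i)) * (g y * (\<Prod>i\<in>#y. v i)))"
  proof (rule sum.reindex_bij_witness[of _ "\<lambda>(x, y). (x + y, x)" "\<lambda>(m, x). (x, m - x)"], goal_cases)
    case (2 a)
    then show ?case
      by (auto simp: multisets_of_size_def size_Diff_submset dest: in_diffD mset_subset_eqD)
  next
    case (5 a)
    then show ?case
      by (auto simp: mult_ac simp flip: prod_mset_Un image_mset_union)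
  qed (auto simp: multisets_of_size_def)
  also have "\<dots> = eval_hom a f v * eval_hom b g v"
    unfolding eval_hom_superset[OF S] sum_product sum.cartesian_product ..
  finally show ?thesis .
qed

text \<open>The j-th Hasse derivative in the variable x_i. The binomial coefficient replaces
  division by j!, so Taylor's formula holds in every characteristic.\<close>

definition hasse :: "nat \<Rightarrow> 'i \<Rightarrow> ('i multiset \<Rightarrow> 'k::comm_ring_1) \<Rightarrow> 'i multiset \<Rightarrow> 'k" where
  "hasse j i f m = of_nat ((count m i + j) choose j) * f (m + replicate_mset j i)"

lemma hom_of_deg_hasse: "hom_of_deg n f \<Longrightarrow> j \<le> n \<Longrightarrow> hom_of_deg (n - j) (hasse j i f)"
  by (auto simp: hom_of_deg_def hasse_def)

lemma prod_mset_shift_coordinate: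
  fixes v :: "'i \<Rightarrow> 'k::comm_ring_1"
  shows "(\<Prod>l\<in>#m. if l = i then v l + s else v l)
    = (\<Sum>j\<le>count m i. of_nat (count m i choose j) * s ^ j * (\<Prod>l\<in>#m - replicate_mset j i. v l))"
proof -
  define k where "k = count m i"
  define m0 where "m0 = filter_mset (\<lambda>l. l \<noteq> i) m"
  have m: "m = m0 + replicate_mset k i"
    by (intro multiset_eqI) (auto simp: m0_def k_def)
  have m0: "(\<Prod>l\<in>#m0. if l = i then v l + s else v l) = (\<Prod>l\<in>#m0. v l)"
    by (intro arg_cong[of _ _ prod_mset] image_mset_cong) (auto simp: m0_def)
  have diff: "m - replicate_mset j i = m0 + replicate_mset (k - j) i" if "j \<le> k" for j
    using that by (intro multiset_eqI) (auto simp: m)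
  have "(\<Prod>l\<in>#m. if l = i then v l + s else v l) = (\<Prod>l\<in>#m0. v l) * (s + v i) ^ k"
    by (subst m) (simp add: m0 add.commute)
  also have "\<dots> = (\<Sum>j\<le>k. of_nat (k choose j) * s ^ j * ((\<Prod>l\<in>#m0. v l) * v i ^ (k - j)))"
    unfolding binomial_ring sum_distrib_left by (intro sum.cong) (auto simp: mult_ac)
  also have "\<dots> = (\<Sum>j\<le>k. of_nat (k choose j) * s ^ j * (\<Prod>l\<in>#m - replicate_mset j i. v l))"
    by (intro sum.cong) (auto simp: diff)
  finally show ?thesis by (simp add: k_def)
qed

lemma eval_hom_shift_coordinate:
  fixes v :: "'i \<Rightarrow> 'k::comm_ring_1"
  assumes "is_vec v"
  shows "eval_hom n f (\<lambda>l. if l = i then v l + s else v l)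
    = (\<Sum>j\<le>n. s ^ j * eval_hom (n - j) (hasse j i f) v)"
proof -
  \<comment> \<open>The shifted vector may be nonzero at \<open>i\<close> even where v is
    not.\<close>
  define S where "S = insert i {i. v i \<noteq> 0}"
  have S: "finite S" "{i. v i \<noteq> 0} \<subseteq> S" "i \<in> S" "{l. (if l = i then v l + s else v l) \<noteq> 0} \<subseteq> S"
    using assms by (auto simp: S_def is_vec_def split: if_splits)
  note fin = finite_multisets_of_size[OF S(1)]
  let ?M = "multisets_of_size S"
  have "eval_hom n f (\<lambda>l. if l = i then v l + s else v l)
      = (\<Sum>m\<in>?M n. \<Sum>j\<le>count m i. f m * (of_nat (count m i choose j) * s ^ j * (\<Prod>l\<in>#m - replicate_mset j i. v l)))"
    unfolding eval_hom_superset[OF S(1,4)] prod_mset_shift_coordinate sum_distrib_left ..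
  also have "\<dots> = (\<Sum>(m, j)\<in>Sigma (?M n) (\<lambda>m. {..count m i}).
      f m * (of_nat (count m i choose j) * s ^ j * (\<Prod>l\<in>#m - replicate_mset j i. v l)))"
    using fin by (intro sum.Sigma) auto
  also have "\<dots> = (\<Sum>(j, m)\<in>Sigma {..n} (\<lambda>j. ?M (n - j)). s ^ j * (hasse j i f m * (\<Prod>l\<in>#m. v l)))"
  proof (rule sum.reindex_bij_witness[of _ "\<lambda>(j, m). (m + replicate_mset j i, j)"
        "\<lambda>(m, j). (j, m - replicate_mset j i)"], goal_cases)
    case (1 a)
    then show ?case by (auto simp: count_le_replicate_mset_subset_eq)
  next
    case (2 a)
    then obtain m j where a: "a = (m, j)" "size m = n" "set_mset m \<subseteq> S" "replicate_mset j i \<subseteq># m"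
      by (auto simp: multisets_of_size_def count_le_replicate_mset_subset_eq)
    then have "j \<le> n" using size_mset_mono by fastforce
    then show ?case using a
      by (auto simp: multisets_of_size_def size_Diff_submset dest: in_diffD)
  next
    case (5 a)
    then show ?case
      by (auto simp: hasse_def mult_ac count_le_replicate_mset_subset_eq)
  qed (use S(3) in \<open>auto simp: multisets_of_size_def split: if_splits\<close>)
  also have "\<dots> = (\<Sum>j\<le>n. s ^ j * eval_hom (n - j) (hasse j i f) v)"
    unfolding eval_hom_superset[OF S(1,2)] sum_distrib_left using fin by (intro sum.Sigma[symmetric]) auto
  finally show ?thesis .
qed

lemma eval_hom_eq_0_imp:
  fixes f :: "'i multiset \<Rightarrow> 'k::alg_closed_field"
  assumes "hom_of_deg n f" "\<And>v. is_vec v \<Longrightarrow> eval_hom n f v = 0"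
  shows "f m = 0"
  using assms
proof (induction n arbitrary: f m rule: less_induct)
  case (less n)
  show ?case
  proof (cases "size m = n \<and> m \<noteq> {#}")
    case False
    then consider "size m \<noteq> n" | "n = 0" "m = {#}" by auto
    then show ?thesis
    proof cases
      case 1
      then show ?thesis using less.prems(1) by (auto simp: hom_of_deg_def)
    next
      case 2
      have "is_vec (\<lambda>_ :: 'i. 0 :: 'k)" by (simp add: is_vec_def)
      then show ?thesis using less.prems(2) 2 eval_hom_0 by metis
    qed
  next
    case True
    then obtain i where i: "i \<in># m" by blast
    \<comment> \<open>Differentiating by the full multiplicity of \<open>i\<close> makes the
      binomial coefficient at the remaining monomial equal to 1, so the coefficient of
      \<open>m\<close> is not lost in positive characteristic.\<close>
    define k where "k = count m i"
    have k: "0 < k" "k \<le> n"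
      using i True count_le_size[of m i] by (auto simp: k_def)
    have "eval_hom (n - k) (hasse k i f) v = 0" if v: "is_vec v" for v
    proof -
      define P where "P = (\<Sum>j\<le>n. monom (eval_hom (n - j) (hasse j i f) v) j)"
      have "poly P s = 0" for s
      proof -
        have "is_vec (\<lambda>l. if l = i then v l + s else v l)"
        proof -
          have "{l. (if l = i then v l + s else v l) \<noteq> 0} \<subseteq> insert i {l. v l \<noteq> 0}" by (auto split: if_splits)
          then show ?thesis using v finite_subset unfolding is_vec_def by blast
        qed
        then have "eval_hom n f (\<lambda>l. if l = i then v l + s else v l) = 0" using less.prems(2) by blast
        then show ?thesis unfolding eval_hom_shift_coordinate[OF v]
          by (simp add: P_def poly_sum poly_monom mult.commute)
      qed
      then have "coeff P k = 0" using poly_eq_0_of_values by (metis coeff_0)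
      then show ?thesis using k by (simp add: P_def coeff_sum)
    qed
    moreover have "hom_of_deg (n - k) (hasse k i f)"
      using k less.prems(1) by (intro hom_of_deg_hasse)
    ultimately have "hasse k i f (m - replicate_mset k i) = 0"
      using less.IH[of "n - k" "hasse k i f"] k by simp
    moreover have "m - replicate_mset k i + replicate_mset k i = m"
      by (intro subset_mset.diff_add) (simp add: k_def count_le_replicate_mset_subset_eq[symmetric])
    ultimately show ?thesis by (simp add: hasse_def k_def)
  qed
qed

section \<open>Finitely supported vectors as a model of the locale\<close>

abbreviation lookup :: "('i \<Rightarrow>\<^sub>0 'k::zero) \<Rightarrow> 'i \<Rightarrow> 'k" where
  "lookup \<equiv> Poly_Mapping.lookup"

definition vec_scale :: "'k::comm_ring_1 \<Rightarrow> ('i \<Rightarrow>\<^sub>0 'k) \<Rightarrow> ('i \<Rightarrow>\<^sub>0 'k)" where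
  "vec_scale t v = Poly_Mapping.map ((*) t) v"

lemma lookup_vec_scale [simp]: "lookup (vec_scale t v) i = t * lookup v i"
  by (simp add: vec_scale_def Poly_Mapping.map.rep_eq when_def)

lemma is_vec_lookup [simp]: "is_vec (lookup v)"
  by (simp add: is_vec_def)

text \<open>The locale wants vectors to form a group as a type, so functions are taken on finitely
  supported maps instead of on the predicate \<open>is_vec\<close>.\<close>

definition hom_space :: "nat \<Rightarrow> (('i \<Rightarrow>\<^sub>0 'k::comm_ring_1) \<Rightarrow> 'k) set" where
  "hom_space n = {(\<lambda>v. eval_hom n f (lookup v)) | f. hom_of_deg n f}"

text \<open>The Taylor axiom for a single direction. It is isolated so that it can be proved for
  coordinate directions and extended to sums of directions.\<close>

definition expandable :: "('i \<Rightarrow>\<^sub>0 'k::comm_ring_1) \<Rightarrow> bool" where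
  "expandable e \<longleftrightarrow> (\<forall>n. \<forall>F\<in>hom_space n. \<exists>D. D 0 = F \<and> (\<forall>j\<le>n. D j \<in> hom_space (n - j)) \<and>
          (\<forall>v t. F (v + vec_scale t e) = (\<Sum>j\<le>n. t ^ j * D j v)))"

lemma hom_space_zero: "(\<lambda>_. 0) \<in> hom_space n"
  unfolding hom_space_def by (intro CollectI exI[of _ "\<lambda>_. 0"]) (auto simp: hom_of_deg_def eval_hom_def)

lemma hom_space_add:
  assumes "F \<in> hom_space n" "G \<in> hom_space n"
  shows "(\<lambda>v. F v + G v) \<in> hom_space n"
proof -
  obtain f g where "hom_of_deg n f" "F = (\<lambda>v. eval_hom n f (lookup v))"
    "hom_of_deg n g" "G = (\<lambda>v. eval_hom n g (lookup v))" using assms by (auto simp: hom_space_def)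
  then show ?thesis unfolding hom_space_def
    by (intro CollectI exI[of _ "\<lambda>m. f m + g m"]) (auto simp: hom_of_deg_def eval_hom_add)
qed

lemma hom_space_sum: "(\<And>i. i \<in> I \<Longrightarrow> f i \<in> hom_space n) \<Longrightarrow> (\<lambda>v. \<Sum>i\<in>I. f i v) \<in> hom_space n"
  by (induction I rule: infinite_finite_induct) (auto intro: hom_space_zero hom_space_add)

lemma expandable_single: "expandable (Poly_Mapping.single i c)"
  unfolding expandable_def
proof (intro allI ballI)
  fix n and F :: "('a \<Rightarrow>\<^sub>0 'b) \<Rightarrow> 'b" assume "F \<in> hom_space n"
  then obtain f where f: "hom_of_deg n f" "F = (\<lambda>v. eval_hom n f (lookup v))" by (auto simp: hom_space_def)
  define g where "g j m = c ^ j * hasse j i f m" for j m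
  define D where "D j v = eval_hom (n - j) (g j) (lookup v)" for j v
  have "g 0 = f" by (auto simp: g_def hasse_def)
  then have "D 0 = F" unfolding D_def f(2) by simp
  moreover have "D j \<in> hom_space (n - j)" if "j \<le> n" for j
  proof -
    have "hom_of_deg (n - j) (g j)" using hom_of_deg_hasse[OF f(1) that] by (auto simp: g_def hom_of_deg_def)
    then show ?thesis unfolding hom_space_def D_def by blast
  qed
  moreover have "F (v + vec_scale t (Poly_Mapping.single i c)) = (\<Sum>j\<le>n. t ^ j * D j v)" for v t
  proof -
    have "lookup (v + vec_scale t (Poly_Mapping.single i c)) = (\<lambda>l. if l = i then lookup v l + t * c else lookup v l)"
      by (auto simp: lookup_add lookup_single when_def)
    then have "F (v + vec_scale t (Poly_Mapping.single i c)) = (\<Sum>j\<le>n. (t * c) ^ j * eval_hom (n - j) (hasse j i f) (lookup v))"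
      using eval_hom_shift_coordinate[OF is_vec_lookup[of v], of n f i "t * c"] by (simp add: f(2))
    also have "\<dots> = (\<Sum>j\<le>n. t ^ j * D j v)"
      unfolding D_def g_def eval_hom_scale by (simp add: power_mult_distrib mult.assoc)
    finally show ?thesis .
  qed
  ultimately show "\<exists>D. D 0 = F \<and> (\<forall>j\<le>n. D j \<in> hom_space (n - j)) \<and>
      (\<forall>v t. F (v + vec_scale t (Poly_Mapping.single i c)) = (\<Sum>j\<le>n. t ^ j * D j v))" by blast
qed

text \<open>Expand along \<open>e\<close>, then expand each coefficient along \<open>e'\<close> with
  the same t, and collect terms by the total power of t.\<close>

lemma expandable_add:
  assumes e: "expandable e" and e': "expandable e'"
  shows "expandable (e + e')"
  unfolding expandable_def
proof (intro allI ballI)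
  fix n and F :: "('a \<Rightarrow>\<^sub>0 'b) \<Rightarrow> 'b" assume "F \<in> hom_space n"
  then obtain D where D: "D 0 = F" "\<And>j. j \<le> n \<Longrightarrow> D j \<in> hom_space (n - j)"
    "\<And>v t. F (v + vec_scale t e) = (\<Sum>j\<le>n. t ^ j * D j v)" using e unfolding expandable_def by blast
  have "\<forall>j\<in>{..n}. \<exists>E. E 0 = D j \<and> (\<forall>l\<le>n - j. E l \<in> hom_space (n - j - l)) \<and>
      (\<forall>v t. D j (v + vec_scale t e') = (\<Sum>l\<le>n - j. t ^ l * E l v))"
    using D(2) e' unfolding expandable_def by blast
  from bchoice[OF this] obtain E where E':
    "\<forall>j\<in>{..n}. E j 0 = D j \<and> (\<forall>l\<le>n - j. E j l \<in> hom_space (n - j - l)) \<and>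
      (\<forall>v t. D j (v + vec_scale t e') = (\<Sum>l\<le>n - j. t ^ l * E j l v))" by blast
  have E: "E j 0 = D j" "l \<le> n - j \<Longrightarrow> E j l \<in> hom_space (n - j - l)"
    "D j (v + vec_scale t e') = (\<Sum>l\<le>n - j. t ^ l * E j l v)" if "j \<le> n" for j l v t
    using bspec[OF E', of j] that by simp_all
  define H where "H k v = (\<Sum>j\<le>k. E j (k - j) v)" for k v
  have "H 0 = F" using E(1)[of 0] D(1) by (auto simp: H_def)
  moreover have "H k \<in> hom_space (n - k)" if "k \<le> n" for k
    unfolding H_def
  proof (rule hom_space_sum)
    fix j assume "j \<in> {..k}"
    then show "E j (k - j) \<in> hom_space (n - k)" using E(2)[of j "k - j"] that by auto
  qed
  moreover have "F (v + vec_scale t (e + e')) = (\<Sum>k\<le>n. t ^ k * H k v)" for v t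
  proof -
    have "v + vec_scale t (e + e') = (v + vec_scale t e') + vec_scale t e"
      by (intro poly_mapping_eqI) (simp add: lookup_add algebra_simps)
    then have "F (v + vec_scale t (e + e')) = (\<Sum>j\<le>n. t ^ j * (\<Sum>l\<le>n - j. t ^ l * E j l v))"
      using E(3) by (simp only: D(3)) simp
    also have "\<dots> = (\<Sum>j\<le>n. \<Sum>l\<le>n - j. t ^ (j + l) * E j l v)"
      by (simp add: sum_distrib_left power_add mult.assoc)
    also have "\<dots> = (\<Sum>(j, l)\<in>Sigma {..n} (\<lambda>j. {..n - j}). t ^ (j + l) * E j l v)"
      by (rule sum.Sigma) auto
    also have "Sigma {..n} (\<lambda>j. {..n - j}) = {(j, l). j + l \<le> n}" by auto
    also have "(\<Sum>(j, l)\<in>{(j, l). j + l \<le> n}. t ^ (j + l) * E j l v)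
        = (\<Sum>k\<le>n. \<Sum>j\<le>k. t ^ (j + (k - j)) * E j (k - j) v)" by (rule sum.triangle_reindex_eq)
    also have "\<dots> = (\<Sum>k\<le>n. t ^ k * H k v)" by (simp add: H_def sum_distrib_left)
    finally show ?thesis .
  qed
  ultimately show "\<exists>D. D 0 = F \<and> (\<forall>j\<le>n. D j \<in> hom_space (n - j)) \<and>
      (\<forall>v t. F (v + vec_scale t (e + e')) = (\<Sum>j\<le>n. t ^ j * D j v))" by blast
qed

lemma expandable: "expandable e"
proof (induction e rule: update_induct)
  case const
  have "0 = Poly_Mapping.single undefined (0 :: 'b)" by simp
  then show ?case using expandable_single by metis
next
  case (update f a b)
  have "Poly_Mapping.update a b f = f + Poly_Mapping.single a b"
    using update.hyps by (intro poly_mapping_eqI) (auto simp: lookup_update lookup_add lookup_single when_def in_keys_iff)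
  then show ?case using expandable_add[OF update.IH expandable_single] by simp
qed

section \<open>Strength of coefficient functions\<close>

lemma strength_le_zero: "strength_le n (\<lambda>_. 0) 0"
  by (simp add: strength_le_def)

lemma strength_le_pmult:
  assumes "hom_of_deg a g" "hom_of_deg b h" "0 < a" "0 < b" "a + b = n"
  shows "strength_le n (pmult g h) 1"
  unfolding strength_le_def using assms
  by (intro exI[of _ "\<lambda>_. g"] exI[of _ "\<lambda>_. h"] exI[of _ "\<lambda>_. a"] exI[of _ "\<lambda>_. b"]) auto

lemma strength_le_scale:
  assumes "strength_le n f s"
  shows "strength_le n (\<lambda>m. c * f m) s"
proof -
  obtain g h dg dh where
    g: "\<forall>j<s. 0 < dg j \<and> dg j < n \<and> 0 < dh j \<and> dh j < n \<and> hom_of_deg (dg j) (g j) \<and> hom_of_deg (dh j) (h j)"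
    and f: "f = (\<lambda>m. \<Sum>j<s. pmult (g j) (h j) m)" using assms by (auto simp: strength_le_def)
  have "(\<lambda>m. c * f m) = (\<lambda>m. \<Sum>j<s. pmult (\<lambda>m. c * g j m) (h j) m)"
    by (simp add: f pmult_def sum_distrib_left mult.assoc)
  moreover have "\<forall>j<s. hom_of_deg (dg j) (\<lambda>m. c * g j m)" using g by (auto simp: hom_of_deg_def)
  ultimately show ?thesis unfolding strength_le_def using g
    by (intro exI[of _ "\<lambda>j m. c * g j m"] exI[of _ h] exI[of _ dg] exI[of _ dh]) auto
qed

lemma strength_le_add:
  assumes "strength_le n f s" "strength_le n f' s'"
  shows "strength_le n (\<lambda>m. f m + f' m) (s + s')"
proof -
  obtain g h dg dh where
    g: "\<forall>j<s. 0 < dg j \<and> dg j < n \<and> 0 < dh j \<and> dh j < n \<and> hom_of_deg (dg j) (g j) \<and> hom_of_deg (dh j) (h j)"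
    and f: "f = (\<lambda>m. \<Sum>j<s. pmult (g j) (h j) m)" using assms(1) by (auto simp: strength_le_def)
  obtain g' h' dg' dh' where
    g': "\<forall>j<s'. 0 < dg' j \<and> dg' j < n \<and> 0 < dh' j \<and> dh' j < n \<and> hom_of_deg (dg' j) (g' j) \<and> hom_of_deg (dh' j) (h' j)"
    and f': "f' = (\<lambda>m. \<Sum>j<s'. pmult (g' j) (h' j) m)" using assms(2) by (auto simp: strength_le_def)
  define G where "G j = (if j < s then g j else g' (j - s))" for j
  define H where "H j = (if j < s then h j else h' (j - s))" for j
  have "(\<Sum>j<s + s'. pmult (G j) (H j) m) = f m + f' m" for m
  proof -
    have "(\<Sum>j<s + s'. pmult (G j) (H j) m) = (\<Sum>j<s. pmult (G j) (H j) m) + (\<Sum>j<s'. pmult (G (s + j)) (H (s + j)) m)"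
      by (induction s') (auto simp: add.assoc)
    then show ?thesis by (simp add: G_def H_def f f')
  qed
  then show ?thesis unfolding strength_le_def using g g'
    by (intro exI[of _ G] exI[of _ H] exI[of _ "\<lambda>j. if j < s then dg j else dg' (j - s)"]
        exI[of _ "\<lambda>j. if j < s then dh j else dh' (j - s)"]) (auto simp: G_def H_def)
qed

interpretation hom_funs: polynomial_functions vec_scale "hom_space :: nat \<Rightarrow> (('i \<Rightarrow>\<^sub>0 'k::alg_closed_field) \<Rightarrow> 'k) set"
proof
  show "vec_scale 0 v = 0" "vec_scale 1 v = v" for v :: "'i \<Rightarrow>\<^sub>0 'k"
    by (intro poly_mapping_eqI; simp)+
  show "F \<in> hom_space 0 \<longleftrightarrow> (\<exists>c. F = (\<lambda>_. c))" for F :: "('i \<Rightarrow>\<^sub>0 'k) \<Rightarrow> 'k"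
  proof
    assume "F \<in> hom_space 0"
    then show "\<exists>c. F = (\<lambda>_. c)" by (auto simp: hom_space_def eval_hom_0)
  next
    assume "\<exists>c. F = (\<lambda>_. c)"
    then obtain c where "F = (\<lambda>_. c)" by blast
    then show "F \<in> hom_space 0" unfolding hom_space_def
      by (intro CollectI exI[of _ "\<lambda>m. if m = {#} then c else 0"]) (auto simp: hom_of_deg_def eval_hom_0)
  qed
  show "(\<lambda>v. F v * G v) \<in> hom_space (m + n)" if FG: "F \<in> hom_space m" "G \<in> hom_space n" for F G :: "('i \<Rightarrow>\<^sub>0 'k) \<Rightarrow> 'k" and m n
  proof -
    obtain f g where "hom_of_deg m f" "F = (\<lambda>v. eval_hom m f (lookup v))"
      "hom_of_deg n g" "G = (\<lambda>v. eval_hom n g (lookup v))" using FG by (auto simp: hom_space_def)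
    then show ?thesis unfolding hom_space_def
      by (intro CollectI exI[of _ "pmult f g"]) (auto simp: eval_hom_pmult hom_of_deg_pmult)
  qed
  show "F (vec_scale t v) = t ^ n * F v" if F: "F \<in> hom_space n" for F and t :: 'k and v :: "'i \<Rightarrow>\<^sub>0 'k" and n
  proof -
    obtain f where f: "F = (\<lambda>v. eval_hom n f (lookup v))" using F by (auto simp: hom_space_def)
    define S where "S = {i. lookup v i \<noteq> 0}"
    have S: "finite S" "{i. lookup v i \<noteq> 0} \<subseteq> S" "{i. lookup (vec_scale t v) i \<noteq> 0} \<subseteq> S" by (auto simp: S_def)
    have scaled: "(\<Prod>i\<in>#m. lookup (vec_scale t v) i) = t ^ size m * (\<Prod>i\<in>#m. lookup v i)" for m
      by (induction m) (auto simp: mult_ac)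
    show ?thesis
      unfolding f eval_hom_superset[OF S(1,2)] eval_hom_superset[OF S(1,3)] scaled sum_distrib_left
      by (intro sum.cong) (auto simp: multisets_of_size_def mult_ac)
  qed
  show "\<exists>D. D 0 = F \<and> (\<forall>j\<le>n. D j \<in> hom_space (n - j)) \<and> (\<forall>v t. F (v + vec_scale t e) = (\<Sum>j\<le>n. t ^ j * D j v))"
    if "F \<in> hom_space n" for F n and e :: "'i \<Rightarrow>\<^sub>0 'k"
    using expandable[of e] that unfolding expandable_def by blast
qed (auto intro: hom_space_zero hom_space_add)

text \<open>Lifts \<open>dec\<close>, which speaks of functions, back to coefficients: the
  \<open>a j\<close> record the use of the given functions, and \<open>w\<close> gathers the
  products.\<close>

lemma dec_imp_strength_le:
  fixes f :: "nat \<Rightarrow> 'i multiset \<Rightarrow> 'k::alg_closed_field"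
  assumes "F \<in> hom_funs.dec n {(\<lambda>v. eval_hom n (f j) (lookup v)) | j. j \<in> J}" and J: "finite J"
  shows "\<exists>a w s. hom_of_deg n w \<and> strength_le n w s \<and>
    (\<forall>v. F v = (\<Sum>j\<in>J. a j * eval_hom n (f j) (lookup v)) + eval_hom n w (lookup v))"
  using assms(1)
proof induction
  case zero
  show ?case
    by (intro exI[of _ "\<lambda>_. 0"] exI[of _ 0] conjI strength_le_zero) (auto simp: hom_of_deg_def eval_hom_def)
next
  case (base F)
  then obtain i where i: "i \<in> J" "F = (\<lambda>v. eval_hom n (f i) (lookup v))" by blast
  have "(\<Sum>j\<in>J. (if j = i then 1 else 0) * eval_hom n (f j) (lookup v)) = F v" for v
  proof -
    have "(\<Sum>j\<in>J. (if j = i then 1 else 0) * eval_hom n (f j) (lookup v))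
        = (\<Sum>j\<in>J. if j = i then eval_hom n (f i) (lookup v) else 0)" by (intro sum.cong) auto
    then show ?thesis using i J by simp
  qed
  then show ?case
    by (intro exI[of _ "\<lambda>j. if j = i then 1 else 0"] exI[of _ "\<lambda>_. 0"] exI[of _ 0] conjI strength_le_zero)
      (auto simp: hom_of_deg_def eval_hom_def)
next
  case (prod G a H b)
  obtain g h where gh: "hom_of_deg a g" "G = (\<lambda>v. eval_hom a g (lookup v))"
    "hom_of_deg b h" "H = (\<lambda>v. eval_hom b h (lookup v))" using prod by (auto simp: hom_space_def)
  have "hom_of_deg n (pmult g h)" "strength_le n (pmult g h) 1"
    using hom_of_deg_pmult[OF gh(1,3)] strength_le_pmult[OF gh(1,3)] prod by auto
  moreover have "G v * H v = eval_hom n (pmult g h) (lookup v)" for v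
    using eval_hom_pmult[OF is_vec_lookup gh(1,3)] prod gh by simp
  ultimately show ?case
    by (intro exI[of _ "\<lambda>_. 0"] exI[of _ "pmult g h"] exI[of _ 1]) auto
next
  case (add F G)
  obtain a w s where F: "hom_of_deg n w" "strength_le n w s"
    "\<And>v. F v = (\<Sum>j\<in>J. a j * eval_hom n (f j) (lookup v)) + eval_hom n w (lookup v)" using add.IH(1) by blast
  obtain b u t where G: "hom_of_deg n u" "strength_le n u t"
    "\<And>v. G v = (\<Sum>j\<in>J. b j * eval_hom n (f j) (lookup v)) + eval_hom n u (lookup v)" using add.IH(2) by blast
  have "hom_of_deg n (\<lambda>m. w m + u m)" using F(1) G(1) by (auto simp: hom_of_deg_def)
  then show ?case using strength_le_add[OF F(2) G(2)]
    by (intro exI[of _ "\<lambda>j. a j + b j"] exI[of _ "\<lambda>m. w m + u m"] exI[of _ "s + t"])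
      (auto simp: F(3) G(3) eval_hom_add ring_distribs sum.distrib)
next
  case (scale F c)
  obtain a w s where F: "hom_of_deg n w" "strength_le n w s"
    "\<And>v. F v = (\<Sum>j\<in>J. a j * eval_hom n (f j) (lookup v)) + eval_hom n w (lookup v)" using scale.IH by blast
  have "hom_of_deg n (\<lambda>m. c * w m)" using F(1) by (auto simp: hom_of_deg_def)
  then show ?case using strength_le_scale[OF F(2)]
    by (intro exI[of _ "\<lambda>j. c * a j"] exI[of _ "\<lambda>m. c * w m"] exI[of _ s])
      (auto simp: F(3) eval_hom_scale ring_distribs sum_distrib_left mult.assoc)
qed

lemma eval_hom_sum: "eval_hom n (\<lambda>m. \<Sum>j\<in>J. a j * f j m) v = (\<Sum>j\<in>J. a j * eval_hom n (f j) v)"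
proof (induction J rule: infinite_finite_induct)
  case (insert j J)
  then show ?case by (simp add: eval_hom_add eval_hom_scale)
qed (auto simp: eval_hom_def)

theorem theorem2p1:
  fixes r :: nat and d :: "nat \<Rightarrow> nat"
    and f :: "nat \<Rightarrow> 'i multiset \<Rightarrow> 'k::alg_closed_field"
    and c :: "nat \<Rightarrow> 'k"
  assumes "\<forall>j<r. 0 < d j \<and> hom_of_deg (d j) (f j)"
    and "inf_collective_strength r d f"
  shows "\<exists>v :: 'i \<Rightarrow> 'k. is_vec v \<and> (\<forall>j<r. eval_hom (d j) (f j) v = c j)"
proof -
  define F where "F j v = eval_hom (d j) (f j) (lookup v)" for j and v :: "'i \<Rightarrow>\<^sub>0 'k"
  have "\<exists>v. \<forall>j\<in>{..<r}. F j v = c j"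
  proof (rule hom_funs.surjective)
    show "0 < d j \<and> F j \<in> hom_space (d j)" if "j \<in> {..<r}" for j
      using assms(1) that unfolding F_def hom_space_def by blast
    show "F i \<notin> hom_funs.dec (d i) {F j | j. j \<in> {..<r} - {i} \<and> d j = d i}" if i: "i \<in> {..<r}" for i
    proof
      assume dec: "F i \<in> hom_funs.dec (d i) {F j | j. j \<in> {..<r} - {i} \<and> d j = d i}"
      define n where "n = d i"
      define J where "J = {j. j < r \<and> d j = n} - {i}"
      have J: "finite J" "insert i J = {j. j < r \<and> d j = n}" "i \<notin> J"
        using i by (auto simp: J_def n_def)
      have "F j = (\<lambda>v. eval_hom n (f j) (lookup v))" if "d j = n" for j
        using that by (auto simp: F_def)
      then have "{F j | j. j \<in> {..<r} - {i} \<and> d j = d i} \<subseteq> {(\<lambda>v. eval_hom n (f j) (lookup v)) | j. j \<in> J}"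
        unfolding J_def n_def by blast
      with dec have "F i \<in> hom_funs.dec n {(\<lambda>v. eval_hom n (f j) (lookup v)) | j. j \<in> J}"
        using hom_funs.dec_mono unfolding n_def by blast
      from dec_imp_strength_le[OF this J(1)] obtain a w s where w: "hom_of_deg n w" "strength_le n w s"
        and eq: "\<And>v. F i v = (\<Sum>j\<in>J. a j * eval_hom n (f j) (lookup v)) + eval_hom n w (lookup v)" by blast
      \<comment> \<open>With these coefficients \<open>h\<close> is f_i minus the sum of the a_j
        f_j. It has the same values as \<open>w\<close>, hence the same coefficients, and so finite
        strength, although the combination is nontrivial with coefficient 1 at i.\<close>
      define b where "b j = (if j = i then 1 else - a j)" for j
      define h where "h m = (\<Sum>j | j < r \<and> d j = n. b j * f j m)" for m
      have hom_h: "hom_of_deg n h"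
        using assms(1) unfolding hom_of_deg_def h_def by (auto intro!: sum.neutral)
      have "h m + - 1 * w m = 0" for m
      proof (rule eval_hom_eq_0_imp)
        show "hom_of_deg n (\<lambda>m. h m + - 1 * w m)" using hom_h w(1) by (auto simp: hom_of_deg_def)
        fix u :: "'i \<Rightarrow> 'k" assume "is_vec u"
        then obtain v where v: "u = lookup v"
          by (metis is_vec_def lookup_Abs_poly_mapping)
        have "eval_hom n h u = (\<Sum>j\<in>insert i J. b j * eval_hom n (f j) u)"
          unfolding h_def eval_hom_sum J(2) ..
        also have "\<dots> = F i v + (\<Sum>j\<in>J. b j * eval_hom n (f j) u)"
          using J(1,3) by (simp add: b_def F_def n_def v)
        also have "(\<Sum>j\<in>J. b j * eval_hom n (f j) u) = - (\<Sum>j\<in>J. a j * eval_hom n (f j) u)"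
          unfolding sum_negf[symmetric] using J(3) by (intro sum.cong) (auto simp: b_def)
        finally show "eval_hom n (\<lambda>m. h m + - 1 * w m) u = 0"
          unfolding eval_hom_add eval_hom_scale using eq[of v] v by simp
      qed
      then have "h = w" by (auto simp: fun_eq_iff)
      then have "strength_le n h s" using w(2) by simp
      moreover have "infinite_strength n h"
      proof -
        have "\<exists>j<r. d j = n \<and> b j \<noteq> 0" using i by (auto simp: b_def n_def intro!: exI[of _ i])
        then show ?thesis using assms(2) unfolding inf_collective_strength_def h_def by blast
      qed
      ultimately show False by (simp add: infinite_strength_def)
    qed
  qed simp
  then obtain v where "\<forall>j\<in>{..<r}. F j v = c j" by blast
  then show ?thesis by (intro exI[of _ "lookup v"]) (auto simp: F_def)
qed

end
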